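(* Let $Q$ be a polytope and $\mathcal{O}$ a facial orientation of its 1-skeleton such that $Q$ is $\mathcal{O}$-directionally simple and $\mathcal{O}$ is the Hasse diagram of a lattice $L$ (on the vertex set of $Q$). Let $u\leq_L v$ and suppose the interval $[u,v]_L$ has $a$ atoms. Then the move graph $\mathcal{M}(u,v,\mathcal{O})$ is connected, and if $a\geq 2$ it is moreover $(a-1)$-connected, i.e. deleting any set of at most $a-2$ vertices of $\mathcal{M}(u,v,\mathcal{O})$ leaves a connected graph.
   Context: An acyclic orientation $\mathcal{O}$ of the 1-skeleton of a polytope $Q$ is a facial orientation if its restriction to every face $F$ of $Q$ has a unique source $\mathrm{srce}(F)$ and a unique sink $\mathrm{sink}(F)$. $Q$ is $\mathcal{O}$-directionally simple if for every vertex $x$ of $Q$ and every subset $E$ of the edges directed out of $x$ under $\mathcal{O}$, there is a distinct face $F_E$ of $Q$ spanned by $E$ (i.e. a face of dimension $|E|$ containing $x$ and the edges of $E$, distinct subsets giving distinct faces). "$\mathcal{O}$ is the Hasse diagram of $L$" means the cover relations of $L$ are exactly the directed edges of $\mathcal{O}$. For a 2-face $F$, its boundary consists of two directed paths from $\mathrm{srce}(F)$ to $\mathrm{sink}(F)$. Two saturated chains from $u$ to $v$ in $L$ (equivalently directed paths in $\mathcal{O}$) differ by a move across the 2-face $F$ if one of them enters $F$ at $\mathrm{srce}(F)$, follows one of the two boundary paths of $F$ to $\mathrm{sink}(F)$, and the other is obtained by replacing this segment by the other boundary path of $F$. The move graph $\mathcal{M}(u,v,\mathcal{O})$ has as vertices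 the saturated chains from $u$ to $v$ in $L$, with an edge between two chains whenever they differ by a single move across a 2-face of $Q$. *)

theory Defs
  imports
    "HOL-Analysis.Polytope"
    "HOL-Algebra.Lattice"
    "Graph_Theory.Digraph_Component"
begin

text \<open>
  Orientations of the 1-skeleton of a polytope are relations on points: a pair \<open>(x, y)\<close> stands
  for the edge with endpoints \<open>x\<close> and \<open>y\<close>, directed from \<open>x\<close> to \<open>y\<close>. As the edges of a polytope
  are segments between two of its vertices, a relation that orients them relates vertices only.
\<close>

definition vertices_of :: "'a::euclidean_space set \<Rightarrow> 'a set" where
  "vertices_of P = {x. x extreme_point_of P}"

definition skeleton_orientation :: "'a::euclidean_space set \<Rightarrow> 'a rel \<Rightarrow> bool" where
  "skeleton_orientation Q ori \<longleftrightarrow>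
     (\<forall>x y. (x, y) \<in> ori \<or> (y, x) \<in> ori \<longleftrightarrow> closed_segment x y edge_of Q) \<and>
     (\<forall>x y. (x, y) \<in> ori \<longrightarrow> (y, x) \<notin> ori)"

definition restrict_orientation :: "'a::euclidean_space rel \<Rightarrow> 'a set \<Rightarrow> 'a rel" where
  "restrict_orientation ori F = {(x, y) \<in> ori. closed_segment x y edge_of F}"

definition is_source :: "'a::euclidean_space rel \<Rightarrow> 'a set \<Rightarrow> 'a \<Rightarrow> bool" where
  "is_source ori F x \<longleftrightarrow> x \<in> vertices_of F \<and> (\<nexists>y. (y, x) \<in> restrict_orientation ori F)"

definition is_sink :: "'a::euclidean_space rel \<Rightarrow> 'a set \<Rightarrow> 'a \<Rightarrow> bool" where
  "is_sink ori F x \<longleftrightarrow> x \<in> vertices_of F \<and> (\<nexists>y. (x, y) \<in> restrict_orientation ori F)"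

definition srce :: "'a::euclidean_space rel \<Rightarrow> 'a set \<Rightarrow> 'a" where
  "srce ori F = (THE x. is_source ori F x)"

definition sink :: "'a::euclidean_space rel \<Rightarrow> 'a set \<Rightarrow> 'a" where
  "sink ori F = (THE x. is_sink ori F x)"

text \<open>In the library the empty set is a face; it has no vertices and is excluded here.\<close>

definition facial_orientation :: "'a::euclidean_space set \<Rightarrow> 'a rel \<Rightarrow> bool" where
  "facial_orientation Q ori \<longleftrightarrow>
     skeleton_orientation Q ori \<and> acyclic ori \<and>
     (\<forall>F. F face_of Q \<and> F \<noteq> {} \<longrightarrow> (\<exists>!x. is_source ori F x) \<and> (\<exists>!x. is_sink ori F x))"

definition out_edges :: "'a::euclidean_space rel \<Rightarrow> 'a \<Rightarrow> 'a set set" where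
  "out_edges ori x = {closed_segment x y | y. (x, y) \<in> ori}"

definition directionally_simple :: "'a::euclidean_space set \<Rightarrow> 'a rel \<Rightarrow> bool" where
  "directionally_simple Q ori \<longleftrightarrow>
     (\<forall>x \<in> vertices_of Q. \<exists>F :: 'a set set \<Rightarrow> 'a set.
        inj_on F (Pow (out_edges ori x)) \<and>
        (\<forall>E \<subseteq> out_edges ori x.
           F E face_of Q \<and> aff_dim (F E) = int (card E) \<and> x \<in> F E \<and> (\<forall>e \<in> E. e \<subseteq> F E)))"

definition cover_rel :: "('a, 'b) gorder_scheme \<Rightarrow> 'a rel" where
  "cover_rel L = {(x, y). x \<in> carrier L \<and> y \<in> carrier L \<and> x \<sqsubset>\<^bsub>L\<^esub> y \<and>
                    (\<nexists>z. z \<in> carrier L \<and> x \<sqsubset>\<^bsub>L\<^esub> z \<and> z \<sqsubset>\<^bsub>L\<^esub> y)}"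

definition interval_atoms :: "('a, 'b) gorder_scheme \<Rightarrow> 'a \<Rightarrow> 'a \<Rightarrow> 'a set" where
  "interval_atoms L u v = {x \<in> \<lbrace>u..v\<rbrace>\<^bsub>L\<^esub>. (u, x) \<in> cover_rel L}"

definition directed_path :: "'a rel \<Rightarrow> 'a \<Rightarrow> 'a \<Rightarrow> 'a list \<Rightarrow> bool" where
  "directed_path R u v p \<longleftrightarrow>
     p \<noteq> [] \<and> hd p = u \<and> last p = v \<and> successively (\<lambda>x y. (x, y) \<in> R) p"

definition saturated_chains :: "('a, 'b) gorder_scheme \<Rightarrow> 'a \<Rightarrow> 'a \<Rightarrow> 'a list set" where
  "saturated_chains L u v = {c. set c \<subseteq> carrier L \<and> directed_path (cover_rel L) u v c}"

text \<open>
  All edges of a 2-face lie on its boundary cycle, so the directed paths from its source to its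
  sink along its edges are exactly its two boundary paths.
\<close>

definition boundary_path :: "'a::euclidean_space rel \<Rightarrow> 'a set \<Rightarrow> 'a list \<Rightarrow> bool" where
  "boundary_path ori F p \<longleftrightarrow>
     directed_path (restrict_orientation ori F) (srce ori F) (sink ori F) p"

definition differ_by_move ::
    "'a::euclidean_space rel \<Rightarrow> 'a set \<Rightarrow> 'a list \<Rightarrow> 'a list \<Rightarrow> bool" where
  "differ_by_move ori F c d \<longleftrightarrow>
     (\<exists>xs p q ys. boundary_path ori F p \<and> boundary_path ori F q \<and> p \<noteq> q \<and>
        c = xs @ p @ ys \<and> d = xs @ q @ ys)"

text \<open>The undirected move graph is represented by the symmetric digraph on the same vertices.\<close>

definition move_graph ::
    "'a::euclidean_space set \<Rightarrow> 'a rel \<Rightarrow> ('a, 'b) gorder_scheme \<Rightarrow> 'a \<Rightarrow> 'a \<Rightarrow>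
      ('a list, 'a list \<times> 'a list) pre_digraph" where
  "move_graph Q ori L u v = with_proj
     \<lparr> pverts = saturated_chains L u v,
       parcs = {(c, d). c \<in> saturated_chains L u v \<and> d \<in> saturated_chains L u v \<and>
                  (\<exists>F. F face_of Q \<and> aff_dim F = 2 \<and> differ_by_move ori F c d)} \<rparr>"

end

theory Submission
  imports Defs
begin

text \<open>
  The sink of a 2-face with source \<open>x\<close> is the join of the two covers \<open>y\<close>, \<open>z\<close> of \<open>x\<close> in it. Going down
  from the top, assume this for all 2-faces with source above \<open>x\<close>. If a vertex on one side of the face
  had, besides its successor on that side, another cover below the sink \<open>t\<close>, the 2-face through these
  two covers would show the same for the successor, and so on up to \<open>t\<close>. Hence \<open>[y, t]\<close> and \<open>[z, t]\<close>
  are the two sides themselves, so they meet only in \<open>t\<close>, and the join of \<open>y\<close> and \<open>z\<close> is \<open>t\<close>.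

  For the connectivity, group the saturated chains from \<open>u\<close> to \<open>v\<close> by their initial segments. An exit of
  a segment \<open>p\<close> is a cover by which \<open>p\<close> continues along a 2-face that it has already begun to follow;
  moving across that face leaves the class of \<open>p\<close>. As two 2-faces share at most an edge, distinct
  faces give distinct exits, and a segment that contains no complete boundary path has at least \<open>a - 1\<close>
  exits. Fewer than \<open>a - 1\<close> deleted chains cannot obstruct all of them, and induction on the
  interval applies to the classes into which the deleted chains are spread.
\<close>

subsection \<open>Directed paths\<close>

lemma directed_path_Cons_iff:
  "directed_path R u v (x # s) \<longleftrightarrow>
     x = u \<and> (s = [] \<and> u = v \<or> (\<exists>b. (u, b) \<in> R \<and> directed_path R b v s))"
  unfolding directed_path_def by (cases s) (auto simp: successively_Cons)

text \<open>The vertex \<open>x\<close> at the cut is kept in both halves, so that each half is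
  again a path with known ends.\<close>

lemma directed_path_append_iff:
  "directed_path R u v (p @ x # s) \<longleftrightarrow>
     directed_path R u x (p @ [x]) \<and> directed_path R x v (x # s)"
proof (induction p arbitrary: u)
  case Nil
  then show ?case by (auto simp: directed_path_def)
next
  case (Cons a p)
  then show ?case by (auto simp: directed_path_Cons_iff)
qed

lemma directed_path_rtrancl: "directed_path R u v p \<Longrightarrow> (u, v) \<in> R\<^sup>*"
  by (induction p arbitrary: u) (auto simp: directed_path_Cons_iff directed_path_def[of R u v "[]" for u]
      intro: converse_rtrancl_into_rtrancl)

lemma rtrancl_directed_path:
  assumes "(u, v) \<in> R\<^sup>*"
  obtains p where "directed_path R u v (u # p)"
  using assms
proof (induction arbitrary: thesis rule: converse_rtrancl_induct)
  case base
  then show ?case by (metis directed_path_Cons_iff)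
next
  case (step y z)
  then show ?case by (metis directed_path_Cons_iff)
qed

lemma directed_path_hd: "directed_path R u v p \<Longrightarrow> \<exists>s. p = u # s"
  unfolding directed_path_def by (cases p) auto

lemma directed_path_last: "directed_path R u v p \<Longrightarrow> \<exists>s. p = s @ [v]"
  unfolding directed_path_def by (metis append_butlast_last_id)

lemma directed_path_mem:
  assumes "directed_path R u v p" "m \<in> set p"
  shows "(u, m) \<in> R\<^sup>*" "(m, v) \<in> R\<^sup>*"
proof -
  obtain p1 p2 where "p = p1 @ m # p2" using assms(2) by (meson split_list)
  then show "(u, m) \<in> R\<^sup>*" "(m, v) \<in> R\<^sup>*"
    using assms(1) directed_path_append_iff directed_path_rtrancl by metis+
qed

lemma directed_path_cycle:
  assumes "acyclic R" "directed_path R u u p"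
  shows "p = [u]"
proof -
  obtain s where p: "p = u # s" using directed_path_hd[OF assms(2)] by blast
  show ?thesis
  proof (cases s)
    case (Cons b s')
    then obtain a where "(u, a) \<in> R" "directed_path R a u s"
      using assms(2) p by (auto simp: directed_path_Cons_iff)
    then have "(u, a) \<in> R" "(a, u) \<in> R\<^sup>*"
      using directed_path_rtrancl by metis+
    then show ?thesis using assms(1) by (meson acyclic_def rtrancl_into_trancl2)
  qed (use p in auto)
qed

lemma directed_path_mono: "R \<subseteq> R' \<Longrightarrow> directed_path R u v p \<Longrightarrow> directed_path R' u v p"
  unfolding directed_path_def using successively_mono by (metis (no_types, lifting) subsetD)

lemma directed_path_edge: "directed_path R u v (xs @ x # y # ys) \<Longrightarrow> (x, y) \<in> R"
  by (auto simp: directed_path_def successively_append_iff successively_Cons split: if_splits)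

subsection \<open>Moves across faces in a finite lattice\<close>

text \<open>\<open>W p q\<close> abstracts that \<open>p\<close> and \<open>q\<close> are the two
  boundary paths of a common 2-face, so that the combinatorial part is free of geometry.
  \<open>W_unique\<close> and \<open>W_triple\<close> both express that two distinct edges at a
  vertex lie in at most one 2-face: two edges leaving \<open>x\<close> in the former, one edge
  entering and one leaving \<open>y\<close> in the latter.\<close>

locale face_moves =
  fixes R :: "'a rel" and W :: "'a list \<Rightarrow> 'a list \<Rightarrow> bool"
  assumes finite_R: "finite R" and acyclic_R: "acyclic R"
    and cover: "(x, z) \<in> R \<Longrightarrow> (x, y) \<in> R\<^sup>* \<Longrightarrow> (y, z) \<in> R\<^sup>* \<Longrightarrow> y = x \<or> y = z"
    and join: "(x, y) \<in> R \<Longrightarrow> (x, z) \<in> R \<Longrightarrow>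
      \<exists>w. (y, w) \<in> R\<^sup>* \<and> (z, w) \<in> R\<^sup>* \<and> (\<forall>v. (y, v) \<in> R\<^sup>* \<and> (z, v) \<in> R\<^sup>* \<longrightarrow> (w, v) \<in> R\<^sup>*)"
    and W_sym: "W p q \<Longrightarrow> W q p"
    and W_form: "W p q \<Longrightarrow> \<exists>x y z p' q'. p = x # y # p' \<and> q = x # z # q' \<and> y \<noteq> z"
    and W_path: "W p q \<Longrightarrow> directed_path R (hd p) (last p) p"
    and W_last: "W p q \<Longrightarrow> last p = last q"
    and W_disjoint: "W p q \<Longrightarrow> m \<in> set p \<Longrightarrow> m \<in> set q \<Longrightarrow> m = hd p \<or> m = last p"
    and W_exists: "(x, y) \<in> R \<Longrightarrow> (x, z) \<in> R \<Longrightarrow> y \<noteq> z \<Longrightarrow> \<exists>p q. W (x # y # p) (x # z # q)"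
    and W_unique: "W (x # y # p) (x # z # q) \<Longrightarrow> W (x # y # p') (x # z # q') \<Longrightarrow> p = p'"
    and W_triple: "W (xs @ x # y # z # ys) q \<Longrightarrow> W (xs' @ x # y # z # ys') q' \<Longrightarrow>
      xs @ x # y # z # ys = xs' @ x # y # z # ys' \<and> q = q'"
begin

section \<open>The sink of a 2-face as a join\<close>

lemma irrefl: "(x, y) \<in> R \<Longrightarrow> (y, x) \<notin> R\<^sup>*"
  using acyclic_R by (meson acyclic_def rtrancl_into_trancl2)

lemma R_neq: "(x, y) \<in> R \<Longrightarrow> x \<noteq> y"
  using irrefl by blast

lemma wf_R: "wf (R\<inverse>)"
  using finite_R acyclic_R by (simp add: finite_acyclic_wf_converse)

lemma W_Cons:
  assumes "W (x # y # p) (x # z # q)"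
  shows "(x, y) \<in> R" "(x, z) \<in> R" "y \<noteq> z" "directed_path R y (last (y # p)) (y # p)"
    "directed_path R z (last (y # p)) (z # q)" "\<exists>b p'. p = b # p'"
proof -
  have 1: "directed_path R x (last (y # p)) (x # y # p)" using W_path[OF assms] by simp
  have l: "last (y # p) = last (z # q)" using W_last[OF assms] by simp
  have 2: "directed_path R x (last (y # p)) (x # z # q)" using W_path[OF W_sym[OF assms]] l by simp
  show yz: "y \<noteq> z" using W_form[OF assms] by auto
  show a: "(x, y) \<in> R" and d: "directed_path R y (last (y # p)) (y # p)"
    using 1 directed_path_Cons_iff by (metis list.distinct(1))+
  show b: "(x, z) \<in> R" and e: "directed_path R z (last (y # p)) (z # q)"
    using 2 directed_path_Cons_iff by (metis list.distinct(1))+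
  show "\<exists>b p'. p = b # p'"
  proof (rule ccontr)
    assume "\<nexists>b p'. p = b # p'"
    \<comment> \<open>If one side were the single edge from \<open>x\<close> to \<open>y\<close>,
      the other side would place \<open>z\<close> strictly between \<open>x\<close> and its cover
      \<open>y\<close>.\<close>
    then have "p = []" by (cases p) auto
    then have "(z, y) \<in> R\<^sup>*" using e directed_path_rtrancl by fastforce
    then show False using cover[OF a _ \<open>(z, y) \<in> R\<^sup>*\<close>] b yz R_neq by blast
  qed
qed

lemma W_length:
  assumes "W p q"
  shows "\<exists>x y r w. p = x # y # r @ [w]"
proof -
  obtain x y z p' q' where f: "p = x # y # p'" "q = x # z # q'" using W_form[OF assms] by blast
  then obtain b r where "p' = b # r" using W_Cons(6)[of x y p' z q'] assms by blast
  then show ?thesis using f by (metis append_butlast_last_id list.distinct(1))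
qed

text \<open>The first assumption is the induction hypothesis of \<open>sink_least\<close>, for faces
  with source strictly above \<open>x\<close>. The induction on \<open>ys\<close> runs down the side
  from \<open>t\<close>; at the last edge the claim is the covering property.\<close>

lemma side_cover_unique:
  assumes IH: "\<And>x' y z p q v. (x, x') \<in> R\<^sup>+ \<Longrightarrow> W (x' # y # p) (x' # z # q) \<Longrightarrow>
      (y, v) \<in> R\<^sup>* \<Longrightarrow> (z, v) \<in> R\<^sup>* \<Longrightarrow> (last (y # p), v) \<in> R\<^sup>*"
    and W: "W (x # xs @ g # h # ys) q"
    and t: "t = last (h # ys)"
    and r: "(g, r) \<in> R" "(r, t) \<in> R\<^sup>*"
  shows "r = h"
  using W t r
proof (induction ys arbitrary: xs g h r)
  case Nil
  then have p: "directed_path R x t (x # xs @ [g, h])" "h = t"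
    using W_path by force+
  then have "(g, h) \<in> R"
    using directed_path_append_iff[of R x t "x # xs" g "[h]"] by (auto simp: directed_path_Cons_iff)
  then show ?case using cover[of g h r] Nil p R_neq by (metis r_into_rtrancl)
next
  case (Cons k ys)
  show ?case
  proof (rule ccontr)
    assume rh: "r \<noteq> h"
    have "directed_path R x t (x # xs @ g # h # k # ys)"
      using W_path[OF Cons.prems(1)] Cons.prems(2) by simp
    then have p: "directed_path R x g ((x # xs) @ [g])" "directed_path R g t (g # h # k # ys)"
      using directed_path_append_iff[of R x t "x # xs" g "h # k # ys"] by auto
    have gh: "(g, h) \<in> R" and hk: "directed_path R h t (h # k # ys)"
      using p(2) by (auto simp: directed_path_Cons_iff)
    obtain b where "(x, b) \<in> R" "directed_path R b g (xs @ [g])"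
      using p(1) by (auto simp: directed_path_Cons_iff)
    then have xg: "(x, g) \<in> R\<^sup>+" using directed_path_rtrancl rtrancl_into_trancl2 by metis
    \<comment> \<open>The face through \<open>h\<close> and \<open>r\<close> has source
      \<open>g\<close>, so its sink is at or below \<open>t\<close>. By the claim for
      \<open>h\<close> it continues from \<open>h\<close> to \<open>k\<close>, as the given face
      does. Sharing two consecutive edges, the two faces coincide, although \<open>g\<close> is
      strictly above the source \<open>x\<close>.\<close>
    obtain p1 q1 where W1: "W (g # h # p1) (g # r # q1)" using W_exists[OF gh Cons.prems(3)] rh by blast
    obtain r1 p2 where p1: "p1 = r1 # p2" using W_Cons[OF W1] by blast
    have l: "(last (h # p1), t) \<in> R\<^sup>*"
      using IH[OF xg W1] directed_path_rtrancl[OF hk] Cons.prems(4) by blast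
    have "directed_path R h (last (h # p1)) (h # r1 # p2)" using W_Cons(4)[OF W1] p1 by simp
    then have hr: "(h, r1) \<in> R" "(r1, t) \<in> R\<^sup>*"
      using l directed_path_rtrancl rtrancl_trans by (metis directed_path_Cons_iff list.distinct(1))+
    have "r1 = k"
      using Cons.IH[of "xs @ [g]" h k r1] Cons.prems hr by simp
    then have "x # xs @ g # h # k # ys = g # h # k # p2"
      using W_triple[of "x # xs" g h k ys q "[]" p2] W1 p1 Cons.prems(1) by simp
    then show False using xg acyclic_R by (auto simp: acyclic_def)
  qed
qed

theorem sink_least:
  assumes "W (x # y # p) (x # z # q)" "(y, v) \<in> R\<^sup>*" "(z, v) \<in> R\<^sup>*"
  shows "(last (y # p), v) \<in> R\<^sup>*"
  using assms
proof (induction x arbitrary: y z p q v rule: wf_induct[OF wf_trancl[OF wf_R]])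
  case (1 x)
  have IH: "(x, x') \<in> R\<^sup>+ \<Longrightarrow> W (x' # y # p) (x' # z # q) \<Longrightarrow>
      (y, v) \<in> R\<^sup>* \<Longrightarrow> (z, v) \<in> R\<^sup>* \<Longrightarrow> (last (y # p), v) \<in> R\<^sup>*" for x' y z p q v
  proof -
    assume a: "(x, x') \<in> R\<^sup>+" "W (x' # y # p) (x' # z # q)" "(y, v) \<in> R\<^sup>*" "(z, v) \<in> R\<^sup>*"
    then have "(x', x) \<in> (R\<inverse>)\<^sup>+" by (simp add: trancl_converse)
    then show ?thesis using 1(1) a by blast
  qed
  \<comment> \<open>Between a vertex \<open>g\<close> of one side and the sink there is nothing but
    the rest of that side.\<close>
  have side: "m \<in> set (g # ys)"
    if "W (x # xs @ g # ys) q" "(g, m) \<in> R\<^sup>*" "(m, last (g # ys)) \<in> R\<^sup>*" for xs g ys q m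
    using that
  proof (induction ys arbitrary: xs g)
    case Nil
    then show ?case using acyclic_R acyclic_impl_antisym_rtrancl antisymD by fastforce
  next
    case (Cons h ys)
    show ?case
    proof (cases "m = g")
      case False
      then obtain r where r: "(g, r) \<in> R" "(r, m) \<in> R\<^sup>*"
        using Cons.prems(2) converse_rtranclE by metis
      have rl: "(r, last (h # ys)) \<in> R\<^sup>*" using rtrancl_trans[OF r(2)] Cons.prems(3) by simp
      have "r = h"
        by (rule side_cover_unique[OF _ Cons.prems(1) refl r(1) rl]) (erule (3) IH)
      then show ?thesis using Cons.IH[of "xs @ [g]" h] Cons.prems r by auto
    qed simp
  qed
  note W = W_Cons[OF 1(2)]
  obtain w where w: "(y, w) \<in> R\<^sup>*" "(z, w) \<in> R\<^sup>*" "\<And>v. (y, v) \<in> R\<^sup>* \<Longrightarrow> (z, v) \<in> R\<^sup>* \<Longrightarrow> (w, v) \<in> R\<^sup>*"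
    using join W(1,2) by metis
  have wt: "(w, last (y # p)) \<in> R\<^sup>*" using w(3) W(4,5) directed_path_rtrancl by metis
  \<comment> \<open>The join \<open>w\<close> of \<open>y\<close> and \<open>z\<close> is at or
    below the sink, so it lies on both sides, and these meet only in the source and the
    sink.\<close>
  have "w \<in> set (y # p)" using side[of "[]" y p "x # z # q" w] 1(2) w wt by simp
  moreover have "w \<in> set (z # q)"
    using side[of "[]" z q "x # y # p" w] W_sym[OF 1(2)] w wt W_last[OF 1(2)] by simp
  ultimately have "w = x \<or> w = last (y # p)" using W_disjoint[OF 1(2), of w] by auto
  then have "w = last (y # p)" using w(1) irrefl[OF W(1)] by blast
  then show ?case using w(3) 1(3,4) by blast
qed

section \<open>Saturated chains, moves and exits\<close>

definition atoms :: "'a \<Rightarrow> 'a \<Rightarrow> 'a set" where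
  "atoms v x = {b. (x, b) \<in> R \<and> (b, v) \<in> R\<^sup>*}"

definition move :: "'a list \<Rightarrow> 'a list \<Rightarrow> bool" where
  "move c d \<longleftrightarrow> (\<exists>xs p q ys. W p q \<and> c = xs @ p @ ys \<and> d = xs @ q @ ys)"

definition moves :: "'a \<Rightarrow> 'a \<Rightarrow> 'a list set \<Rightarrow> 'a list rel" where
  "moves u v S = {(c, d). directed_path R u v c \<and> c \<notin> S \<and> directed_path R u v d \<and> d \<notin> S \<and> move c d}"

text \<open>Vacuous if no chain remains; \<open>remaining_chain\<close> shows separately that one
  does.\<close>

definition chains_connected :: "'a \<Rightarrow> 'a \<Rightarrow> 'a list set \<Rightarrow> bool" where
  "chains_connected u v S \<longleftrightarrow>
     (\<forall>c d. directed_path R u v c \<and> c \<notin> S \<and> directed_path R u v d \<and> d \<notin> S \<longrightarrow>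
        (c, d) \<in> (moves u v S)\<^sup>*)"

text \<open>Both claims of the theorem at once: the alternative \<open>S = {}\<close> covers
  intervals with fewer than two atoms, and the sum on the left avoids a truncated
  difference.\<close>

definition robustly_connected :: "'a \<Rightarrow> 'a \<Rightarrow> bool" where
  "robustly_connected u v \<longleftrightarrow>
     (\<forall>S \<subseteq> Collect (directed_path R u v). finite S \<and> (S = {} \<or> card S + 2 \<le> card (atoms v u)) \<longrightarrow>
        chains_connected u v S)"

definition extensions :: "'a \<Rightarrow> 'a \<Rightarrow> 'a list \<Rightarrow> 'a list set" where
  "extensions u v p = {c. directed_path R u v c \<and> (\<exists>s. c = p @ s)}"

text \<open>All extensions of such a segment run through a full side \<open>q\<close>, so each of
  them can be moved across that face. The count in \<open>exits_card\<close> is restricted to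
  segments without this property.\<close>

definition completed :: "'a list \<Rightarrow> bool" where
  "completed p \<longleftrightarrow> (\<exists>xs q q' ys. W q q' \<and> p = xs @ q @ ys)"

text \<open>Moving across the face \<open>s @ b # zs\<close> leaves \<open>extensions u v p\<close>, since \<open>p\<close> contains its first edge.\<close>

definition exits :: "'a \<Rightarrow> 'a list \<Rightarrow> 'a set" where
  "exits v p = {b. \<exists>xs s zs q. p = xs @ s \<and> 2 \<le> length s \<and> W (s @ b # zs) q \<and>
                     (last (b # zs), v) \<in> R\<^sup>*}"

lemma finite_atoms: "finite (atoms v x)"
  by (rule finite_subset[of _ "snd ` R"]) (use finite_R in \<open>force simp: atoms_def\<close>)+

lemma move_sym: "move c d \<Longrightarrow> move d c"
  unfolding move_def using W_sym by blast

lemma moves_sym: "(c, d) \<in> (moves u v S)\<^sup>* \<Longrightarrow> (d, c) \<in> (moves u v S)\<^sup>*"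
  by (rule symD[OF sym_rtrancl]) (auto simp: sym_def moves_def move_sym)

lemma W_replace:
  assumes "W p q" "directed_path R u v (xs @ p @ ys)"
  shows "directed_path R u v (xs @ q @ ys)"
proof -
  obtain x y z p' q' where f: "p = x # y # p'" "q = x # z # q'" using W_form[OF assms(1)] by blast
  then show ?thesis
    using assms W_path[OF W_sym[OF assms(1)]] W_last[OF assms(1)]
    unfolding directed_path_def successively_append_iff
    by (cases xs; cases ys) (auto simp: successively_append_iff)
qed

text \<open>\<open>s\<close> contains the first edge of its side, and the other side
  \<open>q\<close> starts with a different edge.\<close>

lemma W_leave:
  assumes "W (s @ r) q" "2 \<le> length s"
  shows "xs @ q @ ys \<noteq> (xs @ s) @ t"
proof -
  obtain x y s' where s: "s = x # y # s'" using assms(2) by (cases s; cases "tl s") auto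
  then show ?thesis using W_form[OF assms(1)] by auto
qed

lemma exits_subset: "exits v (p @ [x]) \<subseteq> atoms v x"
proof
  fix b assume "b \<in> exits v (p @ [x])"
  then obtain xs s zs q where e: "p @ [x] = xs @ s" "2 \<le> length s" "W (s @ b # zs) q"
    "(last (b # zs), v) \<in> R\<^sup>*" by (auto simp: exits_def)
  then obtain s' where s: "s = s' @ [x]"
    by (metis append_butlast_last_id last_appendR last_snoc list.size(3) not_numeral_le_zero)
  then have "directed_path R (hd (s @ b # zs)) (last (b # zs)) (s' @ x # b # zs)"
    using W_path[OF e(3)] by simp
  then have "directed_path R x (last (b # zs)) (x # b # zs)"
    using directed_path_append_iff by metis
  then have "(x, b) \<in> R" "directed_path R b (last (b # zs)) (b # zs)"
    by (metis directed_path_Cons_iff list.distinct(1))+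
  then show "b \<in> atoms v x"
    using rtrancl_trans[OF directed_path_rtrancl e(4)] unfolding atoms_def by blast
qed

text \<open>For every atom \<open>d\<close> other than \<open>y\<close>, the face through
  \<open>y\<close> and \<open>d\<close> has its sink at or below \<open>v\<close> by
  \<open>sink_least\<close>, so the vertex that follows \<open>y\<close> on it is an exit. Distinct
  \<open>d\<close> give distinct exits, since faces sharing two consecutive edges coincide. The last
  clause records that these faces start at \<open>x\<close>, which tells them apart from faces begun
  earlier.\<close>

lemma new_exits:
  assumes "y \<in> atoms v x"
  obtains N where "N \<subseteq> exits v (p @ [x, y])" "card (atoms v x) = Suc (card N)"
    "\<And>b. b \<in> N \<Longrightarrow> \<exists>zs q. W (x # y # b # zs) q"
proof -
  have "\<forall>d\<in>atoms v x - {y}. \<exists>b. \<exists>zs q. W (x # y # b # zs) (x # d # q) \<and> (last (b # zs), v) \<in> R\<^sup>*"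
  proof
    fix d assume d: "d \<in> atoms v x - {y}"
    then obtain p1 q where W: "W (x # y # p1) (x # d # q)"
      using W_exists assms unfolding atoms_def by blast
    obtain b zs where p1: "p1 = b # zs" using W_Cons(6)[OF W] by blast
    have "(last (y # p1), v) \<in> R\<^sup>*" using sink_least[OF W] d assms unfolding atoms_def by blast
    then have "(last (b # zs), v) \<in> R\<^sup>*" using p1 by simp
    then show "\<exists>b. \<exists>zs q. W (x # y # b # zs) (x # d # q) \<and> (last (b # zs), v) \<in> R\<^sup>*"
      using W p1 by blast
  qed
  then obtain f where f: "\<And>d. d \<in> atoms v x - {y} \<Longrightarrow>
      \<exists>zs q. W (x # y # f d # zs) (x # d # q) \<and> (last (f d # zs), v) \<in> R\<^sup>*"
    by metis
  have "inj_on f (atoms v x - {y})"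
  proof (rule inj_onI)
    fix d d' assume a: "d \<in> atoms v x - {y}" "d' \<in> atoms v x - {y}" "f d = f d'"
    obtain zs q where 1: "W ([] @ x # y # f d # zs) (x # d # q)" using f[OF a(1)] by auto
    obtain zs' q' where 2: "W ([] @ x # y # f d # zs') (x # d' # q')" using f[OF a(2)] a(3) by auto
    show "d = d'" using W_triple[OF 1 2] by simp
  qed
  then have "card (f ` (atoms v x - {y})) = card (atoms v x) - 1"
    using assms by (simp add: card_image)
  moreover have "card (atoms v x) > 0" using assms finite_atoms card_gt_0_iff by blast
  moreover have "f ` (atoms v x - {y}) \<subseteq> exits v (p @ [x, y])"
  proof (rule image_subsetI)
    fix d assume "d \<in> atoms v x - {y}"
    then obtain zs q where "W ([x, y] @ f d # zs) q" "(last (f d # zs), v) \<in> R\<^sup>*"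
      using f[of d] by auto
    then show "f d \<in> exits v (p @ [x, y])"
      unfolding exits_def using order_refl[of "2::nat"]
      by (intro CollectI exI[of _ p] exI[of _ "[x, y]"] exI[of _ zs] exI[of _ q]) simp
  qed
  moreover have "\<exists>zs q. W (x # y # b # zs) q" if "b \<in> f ` (atoms v x - {y})" for b
    using that f by blast
  ultimately show ?thesis using that by simp
qed

lemma completed_append: "completed p \<Longrightarrow> completed (p @ ys)"
  unfolding completed_def by (metis append.assoc)

text \<open>
  Passing from \<open>p\<close> to \<open>p @ [x]\<close> yields one exit for every other cover of the last vertex of \<open>p\<close>; if
  that is one short of the bound, then all covers were exits before, so the face of the exit \<open>x\<close>
  can be followed further.
\<close>

lemma exits_card:
  assumes "directed_path R u x (p @ [x])" "p \<noteq> []" "(x, v) \<in> R\<^sup>*" "\<not> completed (p @ [x])"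
  shows "card (atoms v u) \<le> Suc (card (exits v (p @ [x])))"
  using assms
proof (induction p arbitrary: x rule: rev_induct)
  case (snoc w p)
  have path: "directed_path R u w (p @ [w])" "directed_path R w x [w, x]"
    using snoc.prems(1) directed_path_append_iff[of R u x p w "[x]"] by auto
  have x: "x \<in> atoms v w"
    using path(2) snoc.prems(3) by (auto simp: atoms_def directed_path_Cons_iff)
  obtain N where N: "N \<subseteq> exits v (p @ [w, x])" "card (atoms v w) = Suc (card N)"
    "\<And>b. b \<in> N \<Longrightarrow> \<exists>zs q. W (w # x # b # zs) q"
    using new_exits[OF x] by metis
  have fin: "finite (exits v (p @ [w, x]))"
    using finite_subset[OF exits_subset[of v "p @ [w]" x] finite_atoms] by simp
  have NE: "card N \<le> card (exits v (p @ [w, x]))" using N(1) fin card_mono by blast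
  show ?case
  proof (cases "p = []")
    case True
    then have "w = u" using path by (auto simp: directed_path_Cons_iff)
    then show ?thesis using N(2) NE True by simp
  next
    case False
    have "(w, v) \<in> R\<^sup>*" using x unfolding atoms_def by (auto intro: converse_rtrancl_into_rtrancl)
    then have IH: "card (atoms v u) \<le> Suc (card (exits v (p @ [w])))"
      using snoc.IH[OF path(1) False] completed_append[of "p @ [w]" "[x]"] snoc.prems(4) by auto
    show ?thesis
    proof (cases "card (atoms v u) \<le> card (atoms v w)")
      case True
      then show ?thesis using N(2) NE by simp
    next
      case False
      then have "exits v (p @ [w]) = atoms v w"
        using IH by (intro card_seteq[OF finite_atoms exits_subset]) linarith
      then have "x \<in> exits v (p @ [w])" using x by simp
      then obtain xs s zs q where e: "p @ [w] = xs @ s" "2 \<le> length s" "W (s @ x # zs) q"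
        "(last (x # zs), v) \<in> R\<^sup>*" by (auto simp: exits_def)
      \<comment> \<open>If the face of the exit \<open>x\<close> ended at \<open>x\<close>, the
        segment would be completed.\<close>
      have "zs \<noteq> []"
      proof
        assume "zs = []"
        then have "completed (xs @ (s @ [x]) @ [])" unfolding completed_def using e(3) by blast
        then show False using snoc.prems(4) e(1) by (metis append.assoc append_Nil2)
      qed
      then obtain b zs' where zs: "zs = b # zs'" by (cases zs) auto
      obtain s' where s: "s = s' @ [w]"
        using e(1,2) by (metis append_butlast_last_id last_appendR last_snoc list.size(3) not_numeral_le_zero)
      have s': "s' \<noteq> []" using e(2) s by auto
      have "p @ [w, x] = xs @ (s @ [x])" using e(1) by (metis append.assoc append_Cons append_Nil)
      moreover have "W ((s @ [x]) @ b # zs') q" "2 \<le> length (s @ [x])" "(last (b # zs'), v) \<in> R\<^sup>*"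
        using e zs by auto
      ultimately have b: "b \<in> exits v (p @ [w, x])" unfolding exits_def by blast
      \<comment> \<open>The faces behind \<open>N\<close> start at \<open>w\<close>, while this one
        starts strictly before \<open>w\<close>; with the edges from \<open>w\<close> to
        \<open>x\<close> and from \<open>x\<close> to \<open>b\<close> in common they would
        coincide.\<close>
      have "b \<notin> N"
      proof
        assume "b \<in> N"
        then obtain zs2 q2 where W2: "W ([] @ w # x # b # zs2) q2" using N(3)[of b] by auto
        have W1: "W (s' @ w # x # b # zs') q" using e(3) s zs by simp
        have "s' @ w # x # b # zs' = [] @ w # x # b # zs2" using W_triple[OF W1 W2] by blast
        then have h: "hd (s' @ w # x # b # zs') = w" by simp
        then have "directed_path R w w (s' @ [w])"
          using W_path[OF W1] directed_path_append_iff by metis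
        then show False using directed_path_cycle[OF acyclic_R] s' by fastforce
      qed
      moreover have "finite N" using N(1) fin finite_subset by blast
      ultimately have "card (insert b N) = Suc (card N)" by simp
      moreover have "card (insert b N) \<le> card (exits v (p @ [w, x]))"
        using b N(1) fin by (intro card_mono) auto
      moreover have "card (exits v (p @ [w])) \<le> card (atoms v w)"
        using exits_subset finite_atoms card_mono by metis
      ultimately show ?thesis using IH N(2) by simp
    qed
  qed
qed simp

section \<open>Classes of chains with a common initial segment\<close>

lemma extensions_iff:
  "c \<in> extensions u v (p @ [x]) \<longleftrightarrow> directed_path R u v c \<and> (\<exists>s. c = p @ x # s)"
  by (auto simp: extensions_def)

lemma extensions_child:
  assumes "c \<in> extensions u v (p @ [x])" "x \<noteq> v"
  obtains b where "b \<in> atoms v x" "c \<in> extensions u v (p @ [x, b])"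
proof -
  obtain s where c: "c = p @ x # s" "directed_path R u v c" using assms(1) extensions_iff by blast
  then have d: "directed_path R x v (x # s)" using directed_path_append_iff by metis
  then obtain b where b: "(x, b) \<in> R" "directed_path R b v s"
    using assms(2) by (auto simp: directed_path_Cons_iff)
  then have "b \<in> atoms v x" using directed_path_rtrancl by (auto simp: atoms_def)
  moreover obtain s' where "s = b # s'" using b(2) directed_path_hd by metis
  ultimately show ?thesis using that[of b] c by (auto simp: extensions_def)
qed

lemma extensions_disjoint:
  "c \<in> extensions u v (p @ [x, b]) \<Longrightarrow> c \<in> extensions u v (p @ [x, b']) \<Longrightarrow> b = b'"
  by (auto simp: extensions_def)

lemma extensions_mono: "extensions u v (p @ q) \<subseteq> extensions u v p"
  by (auto simp: extensions_def)

text \<open>Turns an exit into an actual move: any path \<open>ys\<close> from the sink of the face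
  up to \<open>v\<close> completes both sides of the face to chains.\<close>

lemma exit_chain:
  assumes "directed_path R u x (xs @ s)" "2 \<le> length s" "W (s @ b # zs) q" "(last (b # zs), v) \<in> R\<^sup>*"
  obtains ys where "directed_path R u v ((xs @ s) @ b # zs @ ys)" "directed_path R u v (xs @ q @ ys)"
    "move ((xs @ s) @ b # zs @ ys) (xs @ q @ ys)" "xs @ q @ ys \<notin> extensions u v (xs @ s)"
proof -
  obtain ys where ys: "directed_path R (last (b # zs)) v (last (b # zs) # ys)"
    using rtrancl_directed_path[OF assms(4)] by blast
  obtain p' where p': "b # zs = p' @ [last (b # zs)]" by (metis append_butlast_last_id list.distinct(1))
  obtain s' where s: "s = s' @ [x]"
    using assms(2) directed_path_last[OF assms(1)] by (cases s rule: rev_cases) auto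
  have "directed_path R (hd (s @ b # zs)) (last (b # zs)) (s' @ x # b # zs)"
    using W_path[OF assms(3)] s by simp
  then have "directed_path R x (last (b # zs)) (x # b # zs)" using directed_path_append_iff by metis
  then have "directed_path R x (last (b # zs)) ((x # p') @ [last (b # zs)])"
    using p' by (metis append_Cons)
  then have "directed_path R x v ((x # p') @ last (b # zs) # ys)"
    using ys directed_path_append_iff[of R x v "x # p'" "last (b # zs)" ys] by blast
  then have "directed_path R x v (x # b # zs @ ys)"
    by (metis p' append.assoc append_Cons append_Nil)
  moreover have "directed_path R u x ((xs @ s') @ [x])" using assms(1) s by simp
  ultimately have "directed_path R u v ((xs @ s') @ x # b # zs @ ys)"
    using directed_path_append_iff by metis
  then have d: "directed_path R u v ((xs @ s) @ b # zs @ ys)" using s by simp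
  then have d': "directed_path R u v (xs @ q @ ys)" using W_replace[OF assms(3), of u v xs ys] by simp
  have "move ((xs @ s) @ b # zs @ ys) (xs @ q @ ys)"
    unfolding move_def
    by (rule exI[of _ xs], rule exI[of _ "s @ b # zs"], rule exI[of _ q], rule exI[of _ ys])
      (use assms(3) in simp)
  moreover have "xs @ q @ ys \<notin> extensions u v (xs @ s)"
    using W_leave[OF assms(3,2)] by (auto simp: extensions_def)
  ultimately show ?thesis using that d d' by blast
qed

text \<open>The face through \<open>b\<close> and \<open>l\<close> has its sink at or below
  \<open>v\<close>, by \<open>sink_least\<close>; its two sides with a common continuation up to
  \<open>v\<close> give the two chains.\<close>

lemma sibling_move:
  assumes "directed_path R u x (p @ [x])" "b \<in> atoms v x" "l \<in> atoms v x" "b \<noteq> l"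
  obtains c c' where "c \<in> extensions u v (p @ [x, b])" "c' \<in> extensions u v (p @ [x, l])" "move c c'"
proof -
  obtain p1 q where W: "W (x # b # p1) (x # l # q)"
    using W_exists assms unfolding atoms_def by blast
  obtain b' zs where p1: "p1 = b' # zs" using W_Cons(6)[OF W] by blast
  have "(last (b # p1), v) \<in> R\<^sup>*" using sink_least[OF W] assms unfolding atoms_def by blast
  then have l: "(last (b' # zs), v) \<in> R\<^sup>*" using p1 by simp
  have d: "directed_path R u b (p @ [x, b])"
    using directed_path_append_iff[of R u b p x "[b]"] assms(1,2)
    by (auto simp: atoms_def directed_path_Cons_iff)
  obtain ys where "directed_path R u v ((p @ [x, b]) @ b' # zs @ ys)"
    "directed_path R u v (p @ (x # l # q) @ ys)" "move ((p @ [x, b]) @ b' # zs @ ys) (p @ (x # l # q) @ ys)"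
    using exit_chain[OF d _ _ l, of "x # l # q"] W p1 by auto
  then show ?thesis using that by (auto simp: extensions_def)
qed

lemma moves_lift:
  assumes "directed_path R u x (p @ [x])" "(c, d) \<in> (moves x v T)\<^sup>*"
    and "\<And>s. directed_path R x v s \<Longrightarrow> s \<notin> T \<Longrightarrow> p @ s \<notin> S"
  shows "(p @ c, p @ d) \<in> (moves u v S)\<^sup>*"
  using assms(2)
proof (induction rule: rtrancl_induct)
  case (step y z)
  have ext: "directed_path R u v (p @ s)" if "directed_path R x v s" for s
    using that assms(1) directed_path_hd[OF that] directed_path_append_iff[of R u v p x] by auto
  obtain xs q q' ys where m: "W q q'" "y = xs @ q @ ys" "z = xs @ q' @ ys"
    using step.hyps(2) unfolding moves_def move_def by auto
  have "move (p @ y) (p @ z)"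
    unfolding move_def
    by (rule exI[of _ "p @ xs"], rule exI[of _ q], rule exI[of _ q'], rule exI[of _ ys])
      (use m in simp)
  then have "(p @ y, p @ z) \<in> moves u v S"
    using step.hyps(2) ext assms(3) unfolding moves_def by auto
  then show ?case using step.IH by simp
qed simp

text \<open>Stripping the prefix \<open>p\<close> turns the class into the chains from
  \<open>b\<close> to \<open>v\<close>, and its deleted chains into a set \<open>T\<close> that is
  no larger.\<close>

lemma extensions_connected:
  assumes path: "directed_path R u b (p @ [b])" and "finite S"
    and conn: "robustly_connected b v"
    and card: "S \<inter> extensions u v (p @ [b]) = {} \<or>
      card (S \<inter> extensions u v (p @ [b])) + 2 \<le> card (atoms v b)"
    and cd: "c \<in> extensions u v (p @ [b]) - S" "d \<in> extensions u v (p @ [b]) - S"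
  shows "(c, d) \<in> (moves u v S)\<^sup>*"
proof -
  define T where "T = {s. directed_path R b v s \<and> p @ s \<in> S}"
  have sub: "(@) p ` T \<subseteq> S \<inter> extensions u v (p @ [b])"
  proof (rule image_subsetI)
    fix s assume s: "s \<in> T"
    then obtain s' where "s = b # s'" unfolding T_def using directed_path_hd[of R b v s] by auto
    then show "p @ s \<in> S \<inter> extensions u v (p @ [b])"
      using s path directed_path_append_iff[of R u v p b s'] unfolding T_def extensions_def by auto
  qed
  have TR: "T \<subseteq> Collect (directed_path R b v)" by (auto simp: T_def)
  have inj: "inj_on ((@) p) T" by (simp add: inj_on_def)
  have fin: "finite ((@) p ` T)" using sub \<open>finite S\<close> finite_subset by blast
  then have "finite T" using inj finite_imageD by blast
  moreover have "card T \<le> card (S \<inter> extensions u v (p @ [b]))"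
    using sub \<open>finite S\<close> card_image[OF inj] card_mono by (metis finite_Int)
  ultimately have "chains_connected b v T"
    using conn TR card sub unfolding robustly_connected_def by auto
  moreover obtain s s' where s: "c = p @ b # s" "d = p @ b # s'"
    using cd by (auto simp: extensions_def)
  moreover have "directed_path R b v (b # s)" "directed_path R b v (b # s')"
    using cd s directed_path_append_iff[of R u v p b] by (auto simp: extensions_def)
  moreover have "b # s \<notin> T" "b # s' \<notin> T" using cd s unfolding T_def by auto
  ultimately have "(b # s, b # s') \<in> (moves b v T)\<^sup>*" unfolding chains_connected_def by blast
  then show ?thesis using moves_lift[OF path, of "b # s" "b # s'" v T S] s unfolding T_def by blast
qed

text \<open>
  Each obstructed exit \<open>b'\<close> is charged to a deleted chain: to the one using the exit, or to one in the
  sibling class in which the exit lands. Distinct exits are charged to distinct chains.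
\<close>

lemma free_exit:
  assumes path: "directed_path R u x (p @ [x])" and b: "b \<in> atoms v x"
    and S: "S \<subseteq> extensions u v (p @ [x])" "finite S" "card S < card (exits v (p @ [x, b]))"
  obtains c c' where "c \<in> extensions u v (p @ [x, b]) - S" "move c c'" "directed_path R u v c'" "c' \<notin> S"
    "c' \<notin> extensions u v (p @ [x]) \<or>
     (\<exists>l\<in>atoms v x. l \<noteq> b \<and> c' \<in> extensions u v (p @ [x, l]) \<and> S \<inter> extensions u v (p @ [x, l]) = {})"
proof (rule ccontr)
  note witness = that
  assume "\<not> thesis"
  then have no: "\<not> (c' \<notin> extensions u v (p @ [x]) \<or> (\<exists>l\<in>atoms v x. l \<noteq> b \<and>
      c' \<in> extensions u v (p @ [x, l]) \<and> S \<inter> extensions u v (p @ [x, l]) = {}))"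
    if "c \<in> extensions u v (p @ [x, b]) - S" "move c c'" "directed_path R u v c'" "c' \<notin> S" for c c'
    using that witness by blast
  \<comment> \<open>The charging relation: the deleted chain \<open>s\<close> can be held
    responsible for the obstruction of the exit \<open>b'\<close>.\<close>
  define P where "P b' s \<longleftrightarrow> s \<in> extensions u v (p @ [x, b, b']) \<or>
      (\<exists>l zs q. l \<noteq> b \<and> s \<in> extensions u v (p @ [x, l]) \<and> W (x # b # b' # zs) (x # l # q))" for b' s
  have path': "directed_path R u b (p @ [x, b])"
    using directed_path_append_iff[of R u b p x "[b]"] path b
    by (auto simp: atoms_def directed_path_Cons_iff)
  have "\<exists>s. s \<in> S \<and> P b' s" if b': "b' \<in> exits v (p @ [x, b])" for b'
  proof -
    obtain xs s zs q where e: "p @ [x, b] = xs @ s" "2 \<le> length s" "W (s @ b' # zs) q"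
      "(last (b' # zs), v) \<in> R\<^sup>*" using b' by (auto simp: exits_def)
    obtain ys where ys: "directed_path R u v ((xs @ s) @ b' # zs @ ys)" "directed_path R u v (xs @ q @ ys)"
      "move ((xs @ s) @ b' # zs @ ys) (xs @ q @ ys)" "xs @ q @ ys \<notin> extensions u v (xs @ s)"
      using exit_chain[OF _ e(2-4), of u b xs] path' e(1) by auto
    let ?c = "(xs @ s) @ b' # zs @ ys" and ?c' = "xs @ q @ ys"
    have "?c = (p @ [x, b]) @ b' # zs @ ys" by (simp only: e(1))
    then have ce: "?c \<in> extensions u v (p @ [x, b, b'])"
      using ys(1) unfolding extensions_def by auto
    then have ce': "?c \<in> extensions u v (p @ [x, b])" unfolding extensions_def by auto
    show ?thesis
    proof (cases "?c \<in> S")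
      case True
      then show ?thesis using ce P_def by blast
    next
      case cS: False
      obtain s' where s: "s = s' @ [b]" and xs: "p @ [x] = xs @ s'"
        using e(1,2) by (cases s rule: rev_cases) auto
      show ?thesis
      \<comment> \<open>If the face starts before \<open>x\<close>, the move leaves even the class
        of \<open>p @ [x]\<close>, which contains all deleted chains, so its target is free. If the
        face starts at \<open>x\<close>, the move lands in the class of another atom
        \<open>l\<close>, which must then contain a deleted chain.\<close>
      proof (cases "2 \<le> length s'")
        case True
        then have "?c' \<notin> extensions u v (p @ [x])"
          using W_leave[of s' "b # b' # zs" q xs ys] e(3) s xs unfolding extensions_def by auto
        moreover from this have "?c' \<notin> S" using S(1) by blast
        ultimately show ?thesis using no[OF DiffI[OF ce' cS] ys(3,2)] by blast
      next
        case False
        then have s'1: "length s' = 1" using e(2) s by auto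
        then have s': "s' = [x]" "xs = p" using xs by (cases s' rule: rev_cases; simp)+
        then obtain l q' where q: "q = x # l # q'" "b \<noteq> l"
          using W_form[OF e(3)] s by auto
        have "directed_path R u v (p @ x # l # q' @ ys)" using ys(2) q s' by simp
        then have "directed_path R x v (x # l # q' @ ys)" using directed_path_append_iff by metis
        then have "(x, l) \<in> R" "directed_path R l v (l # q' @ ys)"
          unfolding directed_path_Cons_iff[of R x v x] by (auto simp: directed_path_Cons_iff)
        then have l: "l \<in> atoms v x" using directed_path_rtrancl[of R l v] by (auto simp: atoms_def)
        have c'l: "?c' \<in> extensions u v (p @ [x, l])"
          using ys(2) q s' unfolding extensions_def by auto
        have W: "W (x # b # b' # zs) (x # l # q')" using e(3) s s' q by simp
        have "S \<inter> extensions u v (p @ [x, l]) \<noteq> {}"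
        proof
          assume emp: "S \<inter> extensions u v (p @ [x, l]) = {}"
          then have c'S: "?c' \<notin> S" using c'l by blast
          have "\<exists>l\<in>atoms v x. l \<noteq> b \<and> ?c' \<in> extensions u v (p @ [x, l]) \<and>
              S \<inter> extensions u v (p @ [x, l]) = {}"
            by (rule bexI[OF _ l], intro conjI, rule q(2)[symmetric], rule c'l, rule emp)
          then show False using no[OF DiffI[OF ce' cS] ys(3,2) c'S] by blast
        qed
        then obtain s0 where s0: "s0 \<in> S" "s0 \<in> extensions u v (p @ [x, l])" by blast
        have "P b' s0"
          unfolding P_def using q(2) s0(2) W
          by (intro disjI2 exI[of _ l] exI[of _ zs] exI[of _ q'] conjI) simp_all
        then show ?thesis using s0(1) by blast
      qed
    qed
  qed
  then obtain g where g: "\<And>b'. b' \<in> exits v (p @ [x, b]) \<Longrightarrow> g b' \<in> S \<and> P b' (g b')" by metis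
  \<comment> \<open>A chain through \<open>b\<close> can be charged only for the vertex that follows
    \<open>b\<close> on it. A chain through \<open>l\<close> can be charged only for the
    continuation after \<open>b\<close> of the unique face through \<open>b\<close> and
    \<open>l\<close>.\<close>
  have Pd: "b' = b''" if P: "P b' s" "P b'' s" for b' b'' s
  proof -
    consider (1) "s \<in> extensions u v (p @ [x, b, b'])" "s \<in> extensions u v (p @ [x, b, b''])"
      | (2) l l' zs zs' q q' where "s \<in> extensions u v (p @ [x, l])" "s \<in> extensions u v (p @ [x, l'])"
        "W (x # b # b' # zs) (x # l # q)" "W (x # b # b'' # zs') (x # l' # q')"
      | (3) l where "l \<noteq> b" "s \<in> extensions u v (p @ [x, l])" "s \<in> extensions u v (p @ [x, b])"
      using P unfolding P_def extensions_def by fastforce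
    then show ?thesis
    proof cases
      case 1
      then show ?thesis by (auto simp: extensions_def)
    next
      case 2
      then show ?thesis using W_unique extensions_disjoint by (metis list.inject)
    next
      case 3
      then show ?thesis using extensions_disjoint by metis
    qed
  qed
  have "inj_on g (exits v (p @ [x, b]))"
    by (rule inj_onI) (metis g Pd)
  then have "card (exits v (p @ [x, b])) \<le> card S"
    using g S(2) by (intro card_inj_on_le[of g]) auto
  then show False using S(3) by simp
qed

text \<open>Pigeonhole principle: the classes for distinct \<open>k\<close> are disjoint.\<close>

lemma intact_child:
  assumes "finite S" "card S < card A"
  obtains k where "k \<in> A" "S \<inter> extensions u v (p @ [x, k]) = {}"
proof (rule ccontr)
  note witness = that
  assume "\<not> thesis"
  then have "\<exists>s. s \<in> S \<and> s \<in> extensions u v (p @ [x, k])" if "k \<in> A" for k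
    using that witness by blast
  then obtain g where g: "\<And>k. k \<in> A \<Longrightarrow> g k \<in> S \<and> g k \<in> extensions u v (p @ [x, k])" by metis
  then have "inj_on g A" by (metis extensions_disjoint inj_onI)
  then have "card A \<le> card S" using g assms(1) by (intro card_inj_on_le[of g]) auto
  then show False using assms(2) by simp
qed

section \<open>Connectivity after deletion of chains\<close>

lemma moves_step:
  assumes "(c, d) \<in> (moves u v S)\<^sup>*" "move d e" "directed_path R u v d" "d \<notin> S"
    "directed_path R u v e" "e \<notin> S"
  shows "(c, e) \<in> (moves u v S)\<^sup>*"
  using assms by (auto simp: moves_def intro: rtrancl_into_rtrancl)

lemma child_path:
  assumes "directed_path R u x (p @ [x])" "b \<in> atoms v x"
  shows "directed_path R u b ((p @ [x]) @ [b])" "(u, b) \<in> R\<^sup>+" "(b, v) \<in> R\<^sup>*"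
proof -
  show "directed_path R u b ((p @ [x]) @ [b])"
    using directed_path_append_iff[of R u b p x "[b]"] assms
    by (auto simp: atoms_def directed_path_Cons_iff)
  show "(u, b) \<in> R\<^sup>+" "(b, v) \<in> R\<^sup>*"
    using directed_path_rtrancl[OF assms(1)] assms(2) by (auto simp: atoms_def)
qed

text \<open>A class without deleted chains is connected by the hypothesis on the interval above its
  last vertex, and nothing obstructs a sibling move between two such classes.\<close>

lemma intact_sibling_reach:
  assumes path: "directed_path R u x (p @ [x])" and "finite S"
    and conn: "\<forall>b. (u, b) \<in> R\<^sup>+ \<longrightarrow> robustly_connected b v"
    and l: "l \<in> atoms v x" "S \<inter> extensions u v (p @ [x, l]) = {}" "d \<in> extensions u v (p @ [x, l])"
    and k: "k \<in> atoms v x" "S \<inter> extensions u v (p @ [x, k]) = {}" "e \<in> extensions u v (p @ [x, k])"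
  shows "(d, e) \<in> (moves u v S)\<^sup>*"
proof -
  have within: "(c, d) \<in> (moves u v S)\<^sup>*"
    if "m \<in> atoms v x" "S \<inter> extensions u v (p @ [x, m]) = {}"
      "c \<in> extensions u v (p @ [x, m])" "d \<in> extensions u v (p @ [x, m])" for m c d
    using extensions_connected[OF child_path(1)[OF path that(1)] \<open>finite S\<close> conn[rule_format, OF child_path(2)[OF path that(1)]], of c d]
      that by auto
  show ?thesis
  proof (cases "l = k")
    case True
    then show ?thesis using within l k by blast
  next
    case False
    obtain c c' where c: "c \<in> extensions u v (p @ [x, l])" "c' \<in> extensions u v (p @ [x, k])" "move c c'"
      using sibling_move[OF path l(1) k(1) False] by blast
    have "(d, c) \<in> (moves u v S)\<^sup>*" using within l c by blast
    moreover have "(c, c') \<in> (moves u v S)\<^sup>*"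
      using moves_step[of c c u v S c'] c l(2) k(2) by (auto simp: extensions_def)
    moreover have "(c', e) \<in> (moves u v S)\<^sup>*" using within k c by blast
    ultimately show ?thesis by (meson rtrancl_trans)
  qed
qed

text \<open>The \<open>2\<close> in the bound is what makes the exits, at least
  \<open>card (atoms v u) - 1\<close> many, outnumber the deleted chains.\<close>

lemma not_completed_child:
  assumes path: "directed_path R u x (p @ [x])" and b: "b \<in> atoms v x" and S: "finite S" "card S + 2 \<le> card (atoms v u)"
    and "\<not> completed (p @ [x, b])"
  shows "card S < card (exits v (p @ [x, b]))"
    "card S < card (atoms v b)"
proof -
  show 1: "card S < card (exits v (p @ [x, b]))"
    using exits_card[OF child_path(1)[OF path b] _ child_path(3)[OF path b]] assms(5) S by simp
  have "card (exits v (p @ [x, b])) \<le> card (atoms v b)"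
    using card_mono[OF finite_atoms exits_subset[of v "p @ [x]" b]] by simp
  then show "card S < card (atoms v b)" using 1 by simp
qed

text \<open>As some deleted chain lies outside the class of \<open>b\<close>, the class itself loses
  at most \<open>card S - 1\<close> chains. This meets the bound for the interval above
  \<open>b\<close>, so the remaining class is connected and \<open>c\<close> reaches the free
  exit.\<close>

lemma spread_class_exit:
  assumes path: "directed_path R u x (p @ [x])"
    and conn: "\<forall>b. (u, b) \<in> R\<^sup>+ \<longrightarrow> robustly_connected b v"
    and S: "finite S" "card S + 2 \<le> card (atoms v u)" "S \<subseteq> extensions u v (p @ [x])"
    and b: "b \<in> atoms v x" "\<not> completed (p @ [x, b])" "\<not> S \<subseteq> extensions u v (p @ [x, b])"
    and c: "c \<in> extensions u v (p @ [x, b]) - S"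
  obtains c' where "(c, c') \<in> (moves u v S)\<^sup>*" "directed_path R u v c'"
    "c' \<notin> extensions u v (p @ [x]) \<or>
     (\<exists>l\<in>atoms v x. l \<noteq> b \<and> c' \<in> extensions u v (p @ [x, l]) \<and> S \<inter> extensions u v (p @ [x, l]) = {})"
proof -
  note n = not_completed_child[OF path b(1) S(1,2) b(2)]
  obtain d d' where d: "d \<in> extensions u v (p @ [x, b]) - S" "move d d'" "directed_path R u v d'" "d' \<notin> S"
    "d' \<notin> extensions u v (p @ [x]) \<or>
     (\<exists>l\<in>atoms v x. l \<noteq> b \<and> d' \<in> extensions u v (p @ [x, l]) \<and> S \<inter> extensions u v (p @ [x, l]) = {})"
    using free_exit[OF path b(1) S(3,1) n(1)] by blast
  have "card (S \<inter> extensions u v (p @ [x, b])) < card S"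
    using S(1) b(3) by (intro psubset_card_mono) auto
  then have "card (S \<inter> extensions u v (p @ [x, b])) + 2 \<le> card (atoms v b)" using n(2) by simp
  then have "(c, d) \<in> (moves u v S)\<^sup>*"
    using extensions_connected[OF child_path(1)[OF path b(1)] S(1) conn[rule_format, OF child_path(2)[OF path b(1)]], of c d]
      c d(1) by auto
  then have "(c, d') \<in> (moves u v S)\<^sup>*"
    using moves_step[of c d u v S d'] d by (auto simp: extensions_def)
  then show ?thesis using that d by blast
qed

text \<open>The segment \<open>p\<close> contains the first edge of the face but may stop short of
  its sink by \<open>t\<close>, while \<open>c\<close> runs through all of \<open>q\<close>. The
  move leaves the class of \<open>p\<close>, and with it every deleted chain.\<close>

lemma completed_move:
  assumes "W q q'" "q = s @ t" "2 \<le> length s" "xs @ s = p" "c \<in> extensions u v (xs @ q)"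
    "S \<subseteq> extensions u v p" "c \<notin> S"
  shows "\<exists>c'. directed_path R u v c' \<and> c' \<notin> extensions u v p \<and> (c, c') \<in> (moves u v S)\<^sup>*"
proof -
  obtain ys where ys: "c = xs @ q @ ys" "directed_path R u v c" using assms(5) by (auto simp: extensions_def)
  have 1: "directed_path R u v (xs @ q' @ ys)" using W_replace[OF assms(1)] ys by simp
  have 2: "xs @ q' @ ys \<notin> extensions u v p"
    using W_leave[of s t q' xs ys] assms unfolding extensions_def by auto
  have "move c (xs @ q' @ ys)" unfolding move_def using assms(1) ys by blast
  then have "(c, xs @ q' @ ys) \<in> (moves u v S)\<^sup>*"
    using moves_step[of c c u v S "xs @ q' @ ys"] 1 2 ys assms(6,7) by auto
  then show ?thesis using 1 2 by blast
qed

text \<open>Treats the case that all deleted chains share a segment, by induction from the top on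
  its last vertex \<open>x\<close>, with \<open>u\<close> and \<open>S\<close> fixed. Since there
  are more exits than deleted chains, some exit \<open>k\<close> has a class without deleted chains.
  It remains to bring \<open>c\<close> into any such class, either by induction or, if
  \<open>S\<close> is spread over several classes, by \<open>spread_class_exit\<close>.\<close>

lemma reaches_outside:
  assumes conn: "\<forall>b. (u, b) \<in> R\<^sup>+ \<longrightarrow> robustly_connected b v"
    and S: "finite S" "card S + 2 \<le> card (atoms v u)"
  shows "directed_path R u x (p @ [x]) \<Longrightarrow> p \<noteq> [] \<Longrightarrow> S \<subseteq> extensions u v (p @ [x]) \<Longrightarrow>
    c \<in> extensions u v (p @ [x]) - S \<Longrightarrow>
    \<exists>c'. directed_path R u v c' \<and> c' \<notin> extensions u v (p @ [x]) \<and> (c, c') \<in> (moves u v S)\<^sup>*"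
proof (induction x arbitrary: p c rule: wf_induct_rule[OF wf_R])
  case (1 x)
  note path = 1(2)
  show ?case
  proof (cases "completed (p @ [x])")
    case True
    then obtain xs q q' ys where W: "W q q'" "p @ [x] = xs @ q @ ys" unfolding completed_def by blast
    have "2 \<le> length q" using W_form[OF W(1)] by auto
    moreover have "c \<in> extensions u v (xs @ q)"
      using 1(5) extensions_mono[of u v "xs @ q" ys] W(2) by auto
    moreover have "extensions u v (p @ [x]) \<subseteq> extensions u v (xs @ q)"
      using extensions_mono[of u v "xs @ q" ys] W(2) by simp
    ultimately show ?thesis
      using completed_move[OF W(1), of q "[]" xs "xs @ q" c u v S] 1(4,5) by blast
  next
    case False
    obtain s where s: "c = p @ x # s" "directed_path R u v c" using 1(5) by (auto simp: extensions_def)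
    then have "directed_path R x v (x # s)" using directed_path_append_iff[of R u v p x s] by auto
    then have xv: "(x, v) \<in> R\<^sup>*" by (rule directed_path_rtrancl)
    have E: "card S < card (exits v (p @ [x]))"
      using exits_card[OF path 1(3) xv False] S(2) by simp
    have "x \<noteq> v"
    proof
      assume "x = v"
      then have "atoms v x = {}" using irrefl by (auto simp: atoms_def)
      then show False using E exits_subset[of v p x] by simp
    qed
    then obtain b where b: "b \<in> atoms v x" "c \<in> extensions u v (p @ [x, b])"
      using extensions_child 1(5) by blast
    obtain k where k: "k \<in> exits v (p @ [x])" "S \<inter> extensions u v (p @ [x, k]) = {}"
      using intact_child[OF S(1) E] by metis
    then obtain xs s zs q where e: "p @ [x] = xs @ s" "2 \<le> length s" "W (s @ k # zs) q"
      "(last (k # zs), v) \<in> R\<^sup>*" by (auto simp: exits_def)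
    obtain ys where ys: "directed_path R u v ((xs @ s) @ k # zs @ ys)" "directed_path R u v (xs @ q @ ys)"
      "move ((xs @ s) @ k # zs @ ys) (xs @ q @ ys)" "xs @ q @ ys \<notin> extensions u v (xs @ s)"
      using exit_chain[OF _ e(2-4), of u x xs] path e(1) by auto
    let ?e = "(xs @ s) @ k # zs @ ys" and ?e' = "xs @ q @ ys"
    have "?e = (p @ [x]) @ k # zs @ ys" by (simp only: e(1))
    then have ee: "?e \<in> extensions u v (p @ [x, k])" using ys(1) by (auto simp: extensions_def)
    have e': "?e' \<notin> extensions u v (p @ [x])" using ys(4) e(1) by simp
    \<comment> \<open>A chain that has reached an intact class can go on to \<open>?e\<close> and
      leave through the exit \<open>k\<close>.\<close>
    have intact: "\<exists>c'. directed_path R u v c' \<and> c' \<notin> extensions u v (p @ [x]) \<and> (c, c') \<in> (moves u v S)\<^sup>*"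
      if l: "l \<in> atoms v x" "S \<inter> extensions u v (p @ [x, l]) = {}" "d \<in> extensions u v (p @ [x, l])"
        and cd: "(c, d) \<in> (moves u v S)\<^sup>*" for l d
    proof -
      have "(d, ?e) \<in> (moves u v S)\<^sup>*"
        using intact_sibling_reach[OF path S(1) conn l _ k(2) ee] k(1) exits_subset by blast
      then have "(c, ?e) \<in> (moves u v S)\<^sup>*" using cd by (meson rtrancl_trans)
      then have "(c, ?e') \<in> (moves u v S)\<^sup>*"
        using moves_step ys(1-3) ee k(2) e' 1(4) by blast
      then show ?thesis using ys(2) e' by blast
    qed
    have outcome: ?thesis
      if "(c, c') \<in> (moves u v S)\<^sup>*" "directed_path R u v c'" "c' \<notin> extensions u v (p @ [x]) \<or>
        (\<exists>l\<in>atoms v x. l \<noteq> b \<and> c' \<in> extensions u v (p @ [x, l]) \<and> S \<inter> extensions u v (p @ [x, l]) = {})" for c'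
      using that intact by blast
    show ?thesis
    proof (cases "completed (p @ [x, b])")
      case True
      then obtain xs q q' ys where W: "W q q'" "p @ [x, b] = xs @ q @ ys" unfolding completed_def by blast
      have "ys = []"
      proof (rule ccontr)
        assume "ys \<noteq> []"
        then obtain ys' where "p @ [x] = xs @ q @ ys'" using W(2) by (cases ys rule: rev_cases) auto
        then show False using False W(1) unfolding completed_def by blast
      qed
      \<comment> \<open>A side has at least three vertices, so without its last vertex
        \<open>b\<close> it still contains its first edge, as \<open>completed_move\<close>
        requires.\<close>
      obtain y z r' b' where q: "q = y # z # r' @ [b']" using W_length[OF W(1)] by blast
      have "(p @ [x]) @ [b] = (xs @ y # z # r') @ [b']" using W(2) q \<open>ys = []\<close> by simp
      then have xs: "xs @ (y # z # r') = p @ [x]" "b' = b" by simp_all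
      have "c \<in> extensions u v (xs @ q)" using b(2) W(2) \<open>ys = []\<close> by simp
      then show ?thesis
        using completed_move[OF W(1), of "y # z # r'" "[b]" xs "p @ [x]" c u v S] q xs 1(4,5) by simp
    next
      case nc: False
      show ?thesis
      proof (cases "S \<subseteq> extensions u v (p @ [x, b])")
        case True
        have bx: "(b, x) \<in> R\<inverse>" using b(1) by (auto simp: atoms_def)
        \<comment> \<open>The induction hypothesis for the longer segment leads out of the class of
          \<open>b\<close>. If this does not yet leave the class of \<open>p @ [x]\<close>, it ends
          in a sibling class, which is intact because \<open>S\<close> lies in the class of
          \<open>b\<close>.\<close>
        obtain c1 where c1: "directed_path R u v c1" "c1 \<notin> extensions u v (p @ [x, b])"
          "(c, c1) \<in> (moves u v S)\<^sup>*"
          using 1(1)[OF bx child_path(1)[OF path b(1)], of c] True b(2) 1(5) by auto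
        show ?thesis
        proof (cases "c1 \<in> extensions u v (p @ [x])")
          case True
          obtain l where l: "l \<in> atoms v x" "c1 \<in> extensions u v (p @ [x, l])"
            using extensions_child[OF True \<open>x \<noteq> v\<close>] by blast
          then have "l \<noteq> b" using c1(2) by blast
          then have "S \<inter> extensions u v (p @ [x, l]) = {}"
            using \<open>S \<subseteq> extensions u v (p @ [x, b])\<close> extensions_disjoint by blast
          then show ?thesis using outcome c1 l \<open>l \<noteq> b\<close> by blast
        qed (use c1 in blast)
      next
        case False
        have "c \<in> extensions u v (p @ [x, b]) - S" using b(2) 1(5) by blast
        then show ?thesis
          using spread_class_exit[OF path conn S 1(4) b(1) nc False] outcome by metis
      qed
    qed
  qed
qed

theorem robustly_connected: "robustly_connected u v"
proof (induction u rule: wf_induct_rule[OF wf_trancl[OF wf_R]])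
  case (1 u)
  have conn: "\<forall>b. (u, b) \<in> R\<^sup>+ \<longrightarrow> robustly_connected b v"
    using 1 by (simp add: trancl_converse)
  have path: "directed_path R u u ([] @ [u])" by (simp add: directed_path_def)
  have ext: "c \<in> extensions u v ([] @ [u])" if "directed_path R u v c" for c
    using that directed_path_hd by (fastforce simp: extensions_def)
  have child: "\<exists>b\<in>atoms v u. c \<in> extensions u v ([] @ [u, b])" if "directed_path R u v c" "u \<noteq> v" for c
    using extensions_child[OF ext[OF that(1)] that(2)] by blast
  have "chains_connected u v S" if sub: "S \<subseteq> Collect (directed_path R u v)" and fin: "finite S"
    and card: "S = {} \<or> card S + 2 \<le> card (atoms v u)" for S
  proof (cases "2 \<le> card (atoms v u)")
    case True
    then have S: "card S + 2 \<le> card (atoms v u)" using card by auto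
    have uv: "u \<noteq> v"
    proof
      assume "u = v"
      then have "atoms v u = {}" using irrefl by (auto simp: atoms_def)
      then show False using True by simp
    qed
    obtain k where k: "k \<in> atoms v u" "S \<inter> extensions u v ([] @ [u, k]) = {}"
      using intact_child[OF fin, of "atoms v u"] S by (metis add_lessD1 less_add_same_cancel1 order_less_le_trans zero_less_numeral)
    have "(u, k) \<in> R" "(k, v) \<in> R\<^sup>*" using k(1) by (auto simp: atoms_def)
    then obtain s where "directed_path R k v (k # s)" using rtrancl_directed_path by metis
    then have e: "u # k # s \<in> extensions u v ([] @ [u, k])"
      using \<open>(u, k) \<in> R\<close> by (auto simp: extensions_def directed_path_Cons_iff)
    \<comment> \<open>The chain through the intact class of \<open>k\<close> serves as a hub to
      which every remaining chain is connected.\<close>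
    have reach: "(c, u # k # s) \<in> (moves u v S)\<^sup>*" if c: "directed_path R u v c" "c \<notin> S" for c
    proof -
      obtain b where b: "b \<in> atoms v u" "c \<in> extensions u v ([] @ [u, b])" using child[OF c(1) uv] by blast
      have outcome: ?thesis
        if "(c, c') \<in> (moves u v S)\<^sup>*" "l \<in> atoms v u" "c' \<in> extensions u v ([] @ [u, l])"
          "S \<inter> extensions u v ([] @ [u, l]) = {}" for c' l
        using intact_sibling_reach[OF path fin conn that(2,4,3) k e] that(1)
        by (meson rtrancl_trans)
      show ?thesis
      proof (cases "S \<subseteq> extensions u v ([] @ [u, b])")
        case True
        obtain c1 where c1: "directed_path R u v c1" "c1 \<notin> extensions u v ([] @ [u, b])"
          "(c, c1) \<in> (moves u v S)\<^sup>*"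
          using reaches_outside[OF conn fin S child_path(1)[OF path b(1)], of c] True b(2) c(2) by auto
        obtain l where l: "l \<in> atoms v u" "c1 \<in> extensions u v ([] @ [u, l])"
          using child[OF c1(1) uv] by blast
        then have "l \<noteq> b" using c1(2) by blast
        then have "S \<inter> extensions u v ([] @ [u, l]) = {}"
          using True extensions_disjoint by blast
        then show ?thesis using outcome c1 l by blast
      next
        case False
        \<comment> \<open>A single edge is too short to contain a full side.\<close>
        have "\<not> completed ([] @ [u, b])"
        proof
          assume "completed ([] @ [u, b])"
          then obtain xs q q' ys where W: "W q q'" "[u, b] = xs @ q @ ys" unfolding completed_def by auto
          then show False using W_length[OF W(1)] arg_cong[OF W(2), of length] by auto
        qed
        moreover have "S \<subseteq> extensions u v ([] @ [u])" using sub ext by blast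
        ultimately obtain c' where "(c, c') \<in> (moves u v S)\<^sup>*" "directed_path R u v c'"
          "c' \<notin> extensions u v ([] @ [u]) \<or>
           (\<exists>l\<in>atoms v u. l \<noteq> b \<and> c' \<in> extensions u v ([] @ [u, l]) \<and> S \<inter> extensions u v ([] @ [u, l]) = {})"
          using spread_class_exit[OF path conn fin S _ b(1) _ False, of c] b(2) c(2) by blast
        then show ?thesis using outcome ext by blast
      qed
    qed
    show ?thesis
      unfolding chains_connected_def using reach moves_sym by (meson rtrancl_trans)
  next
    case False
    then have S: "S = {}" using card by auto
    have "(c, d) \<in> (moves u v S)\<^sup>*" if cd: "directed_path R u v c" "directed_path R u v d" for c d
    proof (cases "u = v")
      case True
      then show ?thesis using cd directed_path_cycle[OF acyclic_R] by blast
    next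
      case uv: False
      obtain b b' where b: "b \<in> atoms v u" "c \<in> extensions u v ([] @ [u, b])"
        "b' \<in> atoms v u" "d \<in> extensions u v ([] @ [u, b'])"
        using child cd uv by metis
      \<comment> \<open>With at most one atom all chains lie in one class, and nothing is deleted
        from it.\<close>
      have "b = b'" using False b(1,3) finite_atoms card_le_Suc0_iff_eq[of "atoms v u"] by auto
      then show ?thesis
        using intact_sibling_reach[OF path fin conn b(1) _ b(2,3) _ b(4)] S by simp
    qed
    then show ?thesis unfolding chains_connected_def by blast
  qed
  then show ?case unfolding robustly_connected_def by blast
qed

lemma remaining_chain:
  assumes "(u, v) \<in> R\<^sup>*" "finite S" "S = {} \<or> card S + 2 \<le> card (atoms v u)"
  shows "\<exists>c. directed_path R u v c \<and> c \<notin> S"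
proof (cases "S = {}")
  case True
  then show ?thesis using rtrancl_directed_path[OF assms(1)] by blast
next
  case False
  then have "card S < card (atoms v u)" using assms(3) by simp
  then obtain k where k: "k \<in> atoms v u" "S \<inter> extensions u v ([] @ [u, k]) = {}"
    using intact_child[OF assms(2)] by metis
  have "(u, k) \<in> R" "(k, v) \<in> R\<^sup>*" using k(1) by (auto simp: atoms_def)
  moreover from this obtain s where "directed_path R k v (k # s)" using rtrancl_directed_path by metis
  ultimately have "u # k # s \<in> extensions u v ([] @ [u, k])"
    by (auto simp: extensions_def directed_path_Cons_iff)
  then show ?thesis using k(2) by (auto simp: extensions_def)
qed

end

subsection \<open>Two-dimensional faces\<close>

lemma edge_of_segment_endpoints:
  fixes x y :: "'a::euclidean_space"
  assumes "closed_segment x y edge_of F"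
  shows "x extreme_point_of F" "y extreme_point_of F" "x \<noteq> y"
proof -
  have f: "closed_segment x y face_of F" "aff_dim (closed_segment x y) = 1"
    using assms by (auto simp: edge_of_def)
  show "x extreme_point_of F" "y extreme_point_of F"
    using extreme_point_of_face[OF f(1)] extreme_point_of_segment by blast+
  show "x \<noteq> y" using f(2) by auto
qed

lemma edge_of_segment_other:
  fixes x y :: "'a::euclidean_space"
  assumes "closed_segment x y edge_of F" "z extreme_point_of F" "z \<in> closed_segment x y"
  shows "z = x \<or> z = y"
  using assms extreme_point_of_face extreme_point_of_segment unfolding edge_of_def by metis

lemma face_of_convex_comb:
  fixes a :: "'a::euclidean_space"
  assumes "T face_of S" "r \<in> S" "a \<in> S" "0 < t" "t < 1" "(1 - t) *\<^sub>R r + t *\<^sub>R a \<in> T"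
  shows "a \<in> T"
proof (cases "a = r")
  case True
  then have "(1 - t) *\<^sub>R r + t *\<^sub>R a = a" by (simp add: algebra_simps)
  then show ?thesis using assms(6) by simp
next
  case False
  then have "(1 - t) *\<^sub>R r + t *\<^sub>R a \<in> open_segment r a"
    using assms(4,5) by (auto simp: in_segment)
  then show ?thesis using face_ofD[OF assms(1) _ assms(2,3,6)] by blast
qed

text \<open>Dividing the relation by \<open>N\<close> writes a point \<open>w\<close> of the segment
  from \<open>x\<close> to \<open>y\<close>, hence of \<open>T\<close>, as a convex combination of
  points of \<open>S\<close> in which \<open>a\<close> has positive weight. A face contains every
  such \<open>a\<close>.\<close>

lemma face_of_cone_member:
  fixes a :: "'a::euclidean_space"
  assumes T: "T face_of S" "convex S" "x \<in> T" "y \<in> T" and S: "a \<in> S" "b \<in> S" "d \<in> S"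
    and nn: "0 < l" "0 \<le> m" "0 \<le> k" "0 \<le> n"
    and eq: "n *\<^sub>R (y - x) = l *\<^sub>R (a - x) + m *\<^sub>R (b - x) + k *\<^sub>R (d - x)"
  shows "a \<in> T"
proof -
  \<comment> \<open>This choice gives \<open>w\<close> the nonnegative coefficient \<open>n\<close>
    at \<open>x\<close>, after multiplication by \<open>N\<close>.\<close>
  define N where "N = l + m + k + n"
  define w where "w = (1 - n / N) *\<^sub>R x + (n / N) *\<^sub>R y"
  have N: "N > 0" using nn by (simp add: N_def)
  have "w \<in> T"
    unfolding w_def using T N nn face_of_imp_convex[OF T(1)]
    by (intro convexD_alt) (auto simp: N_def)
  have "N *\<^sub>R w = N *\<^sub>R x + n *\<^sub>R (y - x)"
    using N by (simp add: w_def algebra_simps)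
  then have Nw: "N *\<^sub>R w = l *\<^sub>R a + (m *\<^sub>R b + k *\<^sub>R d + n *\<^sub>R x)"
    unfolding eq by (simp add: N_def algebra_simps)
  have xS: "x \<in> S" using T face_of_imp_subset by blast
  show ?thesis
  proof (cases "m + k + n = 0")
    case True
    then have "m = 0" "k = 0" "n = 0" using nn by auto
    then have "w = a" using Nw N by (simp add: N_def)
    then show ?thesis using \<open>w \<in> T\<close> by simp
  next
    case False
    define M where "M = m + k + n"
    have M: "M > 0" using False nn by (simp add: M_def)
    define r where "r = (m / M) *\<^sub>R b + (k / M) *\<^sub>R d + (n / M) *\<^sub>R x"
    have "m / M + k / M + n / M = 1"
      using M by (simp add: M_def add_divide_distrib[symmetric])
    then have "r \<in> convex hull {b, d, x}"
      unfolding convex_hull_3 r_def using M nn by (intro CollectI exI conjI) auto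
    then have "r \<in> S" using hull_minimal[of "{b, d, x}" S convex] S T(2) xS by blast
    have "M *\<^sub>R r = m *\<^sub>R b + k *\<^sub>R d + n *\<^sub>R x"
      using M by (simp add: r_def algebra_simps)
    then have "N *\<^sub>R w = l *\<^sub>R a + M *\<^sub>R r" using Nw by simp
    then have "w = (1 / N) *\<^sub>R (l *\<^sub>R a + M *\<^sub>R r)"
      using N by (metis divideR_right less_irrefl scaleR_one scaleR_left.minus inverse_eq_divide)
    then have "w = (M / N) *\<^sub>R r + (l / N) *\<^sub>R a" by (simp add: algebra_simps)
    moreover have "1 - l / N = M / N" using N by (simp add: N_def M_def field_simps)
    ultimately have "w = (1 - l / N) *\<^sub>R r + (l / N) *\<^sub>R a" by (simp only:)
    then show ?thesis
      using face_of_convex_comb[OF T(1) \<open>r \<in> S\<close> S(1), of "l / N"] \<open>w \<in> T\<close> N M nn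
      by (simp add: N_def M_def)
  qed
qed

text \<open>Three directions in a plane are linearly dependent. Whatever the signs in the
  dependency, one of the three edges would contain the far endpoint of another, which is a vertex
  not on it.\<close>

lemma polygon_vertex_edges:
  fixes F :: "'a::euclidean_space set"
  assumes F: "convex F" "aff_dim F = 2"
    and e: "closed_segment x a edge_of F" "closed_segment x b edge_of F" "closed_segment x c edge_of F"
  shows "a = b \<or> b = c \<or> a = c"
proof (rule ccontr)
  assume "\<not> ?thesis"
  then have d: "a \<noteq> b" "b \<noteq> c" "a \<noteq> c" by auto
  have no: False
    if e: "closed_segment x a edge_of F" "closed_segment x b edge_of F" "closed_segment x c edge_of F"
      and d: "a \<noteq> b" "b \<noteq> c" "a \<noteq> c"
      and eq: "l *\<^sub>R (a - x) + m *\<^sub>R (b - x) + n *\<^sub>R (c - x) = 0" and l: "l > 0" for a b c l m n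
  proof -
    have ends: "a \<noteq> x" "b \<noteq> x" "c \<noteq> x" and ext: "a extreme_point_of F" "b extreme_point_of F"
      using edge_of_segment_endpoints[OF e(1)] edge_of_segment_endpoints[OF e(2)]
        edge_of_segment_endpoints[OF e(3)] by auto
    have S: "a \<in> F" "b \<in> F" "c \<in> F"
      using edge_of_imp_subset[OF e(1)] edge_of_imp_subset[OF e(2)] edge_of_imp_subset[OF e(3)] by auto
    have f: "closed_segment x a face_of F" "closed_segment x b face_of F" "closed_segment x c face_of F"
      using e by (auto simp: edge_of_def)
    have n1: "a \<notin> closed_segment x b" using edge_of_segment_other[OF e(2) ext(1)] ends d by blast
    have n2: "a \<notin> closed_segment x c" using edge_of_segment_other[OF e(3) ext(1)] ends d by blast
    have n3: "b \<notin> closed_segment x a" using edge_of_segment_other[OF e(1) ext(2)] ends d by blast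
    \<comment> \<open>Negative terms are moved to the other side, which leaves a nonnegative
      combination along a single edge; spare places of \<open>face_of_cone_member\<close> get the
      coefficient \<open>0\<close>.\<close>
    consider "0 \<le> m" "0 \<le> n" | "m < 0" "0 \<le> n" | "0 \<le> m" "n < 0" | "m < 0" "n < 0" by linarith
    then show False
    proof cases
      case 1
      have "0 *\<^sub>R (b - x) = l *\<^sub>R (a - x) + m *\<^sub>R (b - x) + n *\<^sub>R (c - x)" using eq by simp
      then show False
        using face_of_cone_member[OF f(2) F(1) _ _ S(1,2,3) l 1, of x b 0] n1 by simp
    next
      case 2
      have "(- m) *\<^sub>R (b - x) = l *\<^sub>R (a - x) + n *\<^sub>R (c - x) + 0 *\<^sub>R (c - x)"
        using eq by (simp add: algebra_simps)
      then show False
        using face_of_cone_member[OF f(2) F(1) _ _ S(1,3,3) l 2(2), of x b 0 "- m"] n1 2 by simp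
    next
      case 3
      have "(- n) *\<^sub>R (c - x) = l *\<^sub>R (a - x) + m *\<^sub>R (b - x) + 0 *\<^sub>R (b - x)"
        using eq by (simp add: neg_eq_iff_add_eq_0 add.commute)
      then show False
        using face_of_cone_member[OF f(3) F(1) _ _ S(1,2,2) l 3(1), of x c 0 "- n"] n2 3 by simp
    next
      case 4
      have "l *\<^sub>R (a - x) = (- m) *\<^sub>R (b - x) + (- n) *\<^sub>R (c - x) + 0 *\<^sub>R (b - x)"
        using eq by (simp add: eq_neg_iff_add_eq_0 algebra_simps)
      then show False
        using face_of_cone_member[OF f(1) F(1) _ _ S(2,3,2), of x a "- m" "- n" 0 l] n3 4 l by simp
    qed
  qed
  have S: "a \<in> F" "b \<in> F" "c \<in> F" "x \<in> F"
    using edge_of_imp_subset[OF e(1)] edge_of_imp_subset[OF e(2)] edge_of_imp_subset[OF e(3)] by auto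
  let ?V = "{a - x, b - x, c - x}"
  have "?V \<subseteq> (\<lambda>y. y - x) ` F" using S by blast
  moreover have "dim ((\<lambda>y. y - x) ` F) = 2"
    using aff_dim_eq_dim_subtract[of x F] F(2) S(4) by (simp add: hull_inc)
  moreover have "card ?V = 3" using d by simp
  ultimately have "dependent ?V"
    using independent_card_le_dim[of ?V "(\<lambda>y. y - x) ` F"] by auto
  then obtain f where f: "\<exists>v\<in>?V. f v \<noteq> 0" "(\<Sum>v\<in>?V. f v *\<^sub>R v) = 0"
    using dependent_finite[of ?V] by auto
  define l m n where "l = f (a - x)" and "m = f (b - x)" and "n = f (c - x)"
  have eq: "l *\<^sub>R (a - x) + m *\<^sub>R (b - x) + n *\<^sub>R (c - x) = 0"
    using f(2) d by (simp add: l_def m_def n_def add.assoc)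
  have neg: "(- l) *\<^sub>R (a - x) + (- m) *\<^sub>R (b - x) + (- n) *\<^sub>R (c - x) = 0"
    using eq by (metis (no_types, lifting) add.inverse_neutral minus_add_distrib scaleR_minus_left)
  have "l \<noteq> 0 \<or> m \<noteq> 0 \<or> n \<noteq> 0" using f(1) by (auto simp: l_def m_def n_def)
  \<comment> \<open>Negating the dependency and permuting the edges puts a positive coefficient
    first, as \<open>no\<close> requires.\<close>
  then consider "l > 0" | "- l > 0" | "m > 0" | "- m > 0" | "n > 0" | "- n > 0" by linarith
  then show False
  proof cases
    case 1 then show ?thesis using no[OF e d eq] by blast
  next
    case 2 then show ?thesis using no[OF e d neg] by blast
  next
    case 3
    then show ?thesis
      using no[OF e(2,1,3) d(1)[symmetric] d(3,2), of m l n] eq by (simp add: add.commute)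
  next
    case 4
    have "(- m) *\<^sub>R (b - x) + (- l) *\<^sub>R (a - x) + (- n) *\<^sub>R (c - x) = 0"
      using neg by (simp only: add_ac)
    then show ?thesis using no[OF e(2,1,3) d(1)[symmetric] d(3,2) _ 4] by blast
  next
    case 5
    then show ?thesis
      using no[OF e(3,2,1) d(2)[symmetric] d(1)[symmetric] d(3)[symmetric], of n m l] eq
      by (simp add: add_ac)
  next
    case 6
    have "(- n) *\<^sub>R (c - x) + (- m) *\<^sub>R (b - x) + (- l) *\<^sub>R (a - x) = 0"
      using neg by (simp only: add_ac)
    then show ?thesis
      using no[OF e(3,2,1) d(2)[symmetric] d(1)[symmetric] d(3)[symmetric] _ 6] by blast
  qed
qed

text \<open>The intersection is a face containing two distinct edges. In dimension at most 1 it
  would equal both of them, so it has dimension 2 and is all of \<open>F\<close> and all of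
  \<open>G\<close>.\<close>

lemma polygon_face_eq:
  fixes F G :: "'a::euclidean_space set"
  assumes "convex Q" and F: "F face_of Q" "aff_dim F = 2" and G: "G face_of Q" "aff_dim G = 2"
    and x: "closed_segment y x edge_of F" "closed_segment y x edge_of G"
    and z: "closed_segment y z edge_of F" "closed_segment y z edge_of G" and "x \<noteq> z"
  shows "F = G"
proof -
  define H where "H = F \<inter> G"
  have H: "H face_of Q" unfolding H_def by (rule face_of_Int[OF F(1) G(1)])
  have sub: "closed_segment y x \<subseteq> H" "closed_segment y z \<subseteq> H"
    unfolding H_def using x z edge_of_imp_subset by blast+
  have eH: "e = H" if "e edge_of F" "e \<subseteq> H" "aff_dim H \<le> 1" for e
  proof -
    have "e face_of H"
      using that face_of_subset[of e F H] unfolding edge_of_def H_def by auto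
    then show ?thesis
      using face_of_aff_dim_lt[OF face_of_imp_convex[OF H], of e] that unfolding edge_of_def by force
  qed
  have "\<not> aff_dim H \<le> 1"
  proof
    assume H1: "aff_dim H \<le> 1"
    then have "closed_segment y x = closed_segment y z" using eH[OF x(1)] eH[OF z(1)] sub by simp
    then have "z \<in> closed_segment y x" using ends_in_segment(2) by metis
    then show False
      using edge_of_segment_other[OF x(1) edge_of_segment_endpoints(2)[OF z(1)]]
        edge_of_segment_endpoints(3)[OF z(1)] \<open>x \<noteq> z\<close> by blast
  qed
  moreover have "H = K" if "K face_of Q" "aff_dim K = 2" "H \<subseteq> K" "\<not> aff_dim H \<le> 1" for K
  proof (rule ccontr)
    assume "H \<noteq> K"
    then have "aff_dim H < aff_dim K"
      using face_of_aff_dim_lt[OF face_of_imp_convex[OF that(1)]] face_of_face[OF that(1)] H that(3) by blast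
    then show False using that by simp
  qed
  ultimately have "H = F" "H = G" using F G unfolding H_def by blast+
  then show ?thesis by simp
qed

section \<open>The oriented boundary of a polygon as an abstract digraph\<close>

locale polygon_orientation =
  fixes E :: "'a rel" and s t :: 'a
  assumes finite_E: "finite E" and acyclic_E: "acyclic E"
    and indegree: "(a, c) \<in> E \<Longrightarrow> (b, c) \<in> E \<Longrightarrow> c \<noteq> t \<Longrightarrow> a = b"
    and outdegree: "(a, b) \<in> E \<Longrightarrow> (a, c) \<in> E \<Longrightarrow> a \<noteq> s \<Longrightarrow> b = c"
    and source_degree: "(s, a) \<in> E \<Longrightarrow> (s, b) \<in> E \<Longrightarrow> (s, c) \<in> E \<Longrightarrow> a = b \<or> b = c \<or> a = c"
    and source: "(a, s) \<notin> E" and sink: "(t, a) \<notin> E"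
    and progress: "(a, b) \<in> E \<Longrightarrow> b \<noteq> t \<Longrightarrow> \<exists>c. (b, c) \<in> E"
begin

lemma path_to_sink: "(a, b) \<in> E \<Longrightarrow> \<exists>p. directed_path E b t (b # p)"
proof (induction b arbitrary: a rule: wf_induct_rule[OF finite_acyclic_wf_converse[OF finite_E acyclic_E]])
  case (1 b)
  show ?case
  proof (cases "b = t")
    case True
    then show ?thesis by (auto simp: directed_path_Cons_iff)
  next
    case False
    then obtain c where c: "(b, c) \<in> E" using progress 1(2) by blast
    then obtain p where "directed_path E c t (c # p)" using 1(1)[of c b] by auto
    then show ?thesis using c by (metis directed_path_Cons_iff)
  qed
qed

lemma forward_unique:
  "directed_path E b t p \<Longrightarrow> directed_path E b t q \<Longrightarrow> b \<noteq> s \<Longrightarrow> p = q"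
proof (induction p arbitrary: b q)
  case Nil
  then show ?case by (simp add: directed_path_def)
next
  case (Cons x p)
  obtain q' where q: "q = b # q'" using directed_path_hd[OF Cons.prems(2)] by blast
  have x: "x = b" using Cons.prems(1) by (simp add: directed_path_Cons_iff)
  show ?case
  proof (cases "b = t")
    case True
    then show ?thesis
      using directed_path_cycle[OF acyclic_E] Cons.prems(1,2) by metis
  next
    case False
    then obtain c d where "(b, c) \<in> E" "directed_path E c t p" "(b, d) \<in> E" "directed_path E d t q'"
      using Cons.prems(1,2) q by (auto simp: directed_path_Cons_iff)
    moreover from this have "c = d" "c \<noteq> s" using outdegree Cons.prems(3) source by blast+
    ultimately show ?thesis using Cons.IH q x by blast
  qed
qed

lemma backward_unique:
  "directed_path E s b p \<Longrightarrow> directed_path E s b q \<Longrightarrow> b \<noteq> t \<Longrightarrow> p = q"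
proof (induction p arbitrary: b q rule: rev_induct)
  case Nil
  then show ?case by (simp add: directed_path_def)
next
  case (snoc x p)
  have last: "\<exists>c. (c, b) \<in> E \<and> directed_path E s c r"
    if "directed_path E s b (r @ [b])" "b \<noteq> s" for r
  proof (cases r rule: rev_cases)
    case (snoc r' c)
    then show ?thesis
      using that directed_path_append_iff[of E s b r' c "[b]"] by (auto simp: directed_path_Cons_iff)
  qed (use that in \<open>auto simp: directed_path_Cons_iff\<close>)
  obtain q' where q: "q = q' @ [b]" using directed_path_last[OF snoc.prems(2)] by blast
  have x: "x = b" using directed_path_last[OF snoc.prems(1)] by auto
  show ?case
  proof (cases "b = s")
    case True
    then show ?thesis
      using directed_path_cycle[OF acyclic_E] snoc.prems(1,2) by metis
  next
    case False
    then obtain c d where cd: "(c, b) \<in> E" "directed_path E s c p" "(d, b) \<in> E" "directed_path E s d q'"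
      using last snoc.prems(1,2) q x by metis
    then have "c = d" "c \<noteq> t" using indegree snoc.prems(3) sink by blast+
    then show ?thesis using snoc.IH cd q x by blast
  qed
qed

lemma boundary_path_form:
  assumes "directed_path E s t p" "directed_path E s t q" "p \<noteq> q"
  shows "\<exists>y z p' q'. p = s # y # p' \<and> q = s # z # q' \<and> y \<noteq> z \<and> (s, y) \<in> E \<and> (s, z) \<in> E \<and>
    directed_path E y t (y # p') \<and> directed_path E z t (z # q')"
proof -
  have "s \<noteq> t" using directed_path_cycle[OF acyclic_E] assms by metis
  have dec: "\<exists>y p'. p = s # y # p' \<and> (s, y) \<in> E \<and> directed_path E y t (y # p')"
    if path: "directed_path E s t p" for p
  proof -
    obtain r where r: "p = s # r" using directed_path_hd[OF path] by blast
    then obtain y where y: "(s, y) \<in> E" "directed_path E y t r"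
      using path \<open>s \<noteq> t\<close> by (auto simp: directed_path_Cons_iff)
    then show ?thesis using r directed_path_hd[OF y(2)] by blast
  qed
  obtain y p' where y: "p = s # y # p'" "(s, y) \<in> E" "directed_path E y t (y # p')"
    using dec[OF assms(1)] by blast
  obtain z q' where z: "q = s # z # q'" "(s, z) \<in> E" "directed_path E z t (z # q')"
    using dec[OF assms(2)] by blast
  have "y \<noteq> z" using forward_unique[of y "y # p'" "z # q'"] y z assms(3) source by auto
  then show ?thesis using y z by blast
qed

lemma boundary_path_determined:
  assumes "directed_path E s t (s # y # p)" "directed_path E s t (s # y # q)"
  shows "p = q"
  using boundary_path_form[OF assms] by auto

text \<open>The middle vertex \<open>y\<close> has an incoming and an outgoing edge, so it is
  neither \<open>s\<close> nor \<open>t\<close>; hence both the way from \<open>s\<close> to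
  \<open>y\<close> and the way from \<open>y\<close> to \<open>t\<close> are forced.\<close>

lemma boundary_path_triple:
  assumes "directed_path E s t (xs @ x # y # z # ys)" "directed_path E s t (xs' @ x # y # z # ys')"
  shows "xs @ x # y # z # ys = xs' @ x # y # z # ys'"
proof -
  have p: "directed_path E s y (xs @ [x, y])" "directed_path E y t (y # z # ys)"
    using assms(1) directed_path_append_iff[of E s t "xs @ [x]" y "z # ys"] by auto
  have p': "directed_path E s y (xs' @ [x, y])" "directed_path E y t (y # z # ys')"
    using assms(2) directed_path_append_iff[of E s t "xs' @ [x]" y "z # ys'"] by auto
  have "(x, y) \<in> E"
    using p(1) directed_path_append_iff[of E s y xs x "[y]"] by (auto simp: directed_path_Cons_iff)
  then have "y \<noteq> s" using source by blast
  moreover have "y \<noteq> t" using p(2) sink by (auto simp: directed_path_Cons_iff)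
  ultimately show ?thesis using backward_unique[OF p(1) p'(1)] forward_unique[OF p(2) p'(2)] by simp
qed

lemma boundary_paths_disjoint:
  assumes "directed_path E s t p" "directed_path E s t q" "p \<noteq> q" "m \<in> set p" "m \<in> set q"
  shows "m = s \<or> m = t"
proof (rule ccontr)
  assume m: "\<not> (m = s \<or> m = t)"
  obtain p1 p2 where p: "p = p1 @ m # p2" using assms(4) by (meson split_list)
  obtain q1 q2 where q: "q = q1 @ m # q2" using assms(5) by (meson split_list)
  have "p1 @ [m] = q1 @ [m]"
    using backward_unique[of m "p1 @ [m]" "q1 @ [m]"] assms(1,2) p q m directed_path_append_iff
    by metis
  moreover have "m # p2 = m # q2"
    using forward_unique[of m "m # p2" "m # q2"] assms(1,2) p q m directed_path_append_iff
    by metis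
  ultimately show False using p q assms(3) by simp
qed

text \<open>The first edge determines a boundary path, and at most two edges leave
  \<open>s\<close>.\<close>

lemma boundary_path_other:
  assumes "directed_path E s t p" "directed_path E s t q" "directed_path E s t q'" "p \<noteq> q" "p \<noteq> q'"
  shows "q = q'"
proof (rule ccontr)
  assume "q \<noteq> q'"
  obtain y z p1 q1 where 1: "p = s # y # p1" "q = s # z # q1" "y \<noteq> z" "(s, y) \<in> E" "(s, z) \<in> E"
    using boundary_path_form[OF assms(1,2,4)] by blast
  obtain w q2 where 2: "q' = s # w # q2" "y \<noteq> w" "(s, w) \<in> E"
    using boundary_path_form[OF assms(1,3,5)] 1(1) by auto
  have "z = w" using source_degree[OF 1(4,5) 2(3)] 1(3) 2(2) by blast
  then show False using boundary_path_determined assms(2,3) 1(2) 2(1) \<open>q \<noteq> q'\<close> by metis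
qed

end

section \<open>From the polytope and its lattice to the abstract setting\<close>

lemma restrict_orientationD:
  assumes "(x, y) \<in> restrict_orientation ori F"
  shows "(x, y) \<in> ori" "closed_segment x y edge_of F"
  using assms by (auto simp: restrict_orientation_def)

lemma finite_skeleton_orientation:
  assumes "polytope Q" "skeleton_orientation Q ori"
  shows "finite ori"
proof (rule finite_subset)
  show "ori \<subseteq> vertices_of Q \<times> vertices_of Q"
    using assms(2) edge_of_segment_endpoints
    unfolding skeleton_orientation_def vertices_of_def by fast
  show "finite (vertices_of Q \<times> vertices_of Q)"
    using finite_polyhedron_extreme_points[OF polytope_imp_polyhedron[OF assms(1)]]
    by (simp add: vertices_of_def)
qed

text \<open>By uniqueness of the sink every other vertex has an outgoing edge. As at most two edges
  meet at a vertex, at most one incoming edge is left there; dually for outgoing edges away from the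
  source.\<close>

lemma polygon_orientation_face:
  assumes Q: "polytope Q" "facial_orientation Q ori" and F: "F face_of Q" "aff_dim F = 2"
  shows "is_source ori F (srce ori F)"
    and "\<And>x. is_source ori F x \<Longrightarrow> x = srce ori F"
    and "polygon_orientation (restrict_orientation ori F) (srce ori F) (sink ori F)"
proof -
  have sk: "skeleton_orientation Q ori" "acyclic ori" using Q(2) by (auto simp: facial_orientation_def)
  have "F \<noteq> {}" using F(2) by auto
  then have ex: "\<exists>!x. is_source ori F x" "\<exists>!x. is_sink ori F x"
    using Q(2) F(1) by (auto simp: facial_orientation_def)
  show src: "is_source ori F (srce ori F)" unfolding srce_def by (rule theI'[OF ex(1)])
  show "\<And>x. is_source ori F x \<Longrightarrow> x = srce ori F" using src ex(1) by blast
  have snk: "is_sink ori F (sink ori F)" unfolding sink_def by (rule theI'[OF ex(2)])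
  have convF: "convex F" using F(1) face_of_imp_convex by blast
  let ?E = "restrict_orientation ori F"
  have edges: "closed_segment x y edge_of F" "closed_segment y x edge_of F"
    "x \<in> vertices_of F" "y \<in> vertices_of F" if "(x, y) \<in> ?E" for x y
    using restrict_orientationD(2)[OF that] edge_of_segment_endpoints
    by (auto simp: vertices_of_def closed_segment_commute)
  have asym: "x \<noteq> z" if "(x, y) \<in> ?E" "(y, z) \<in> ?E" for x y z
    using that sk(1) restrict_orientationD(1) unfolding skeleton_orientation_def by metis
  have out: "\<exists>c. (x, c) \<in> ?E" if "x \<in> vertices_of F" "x \<noteq> sink ori F" for x
    using that ex(2) snk unfolding is_sink_def by blast
  have into: "\<exists>c. (c, x) \<in> ?E" if "x \<in> vertices_of F" "x \<noteq> srce ori F" for x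
    using that ex(1) src unfolding is_source_def by blast
  note two = polygon_vertex_edges[OF convF F(2)]
  show "polygon_orientation ?E (srce ori F) (sink ori F)"
  proof
    have "?E \<subseteq> ori" by (auto simp: restrict_orientation_def)
    then show "finite ?E" "acyclic ?E"
      using finite_skeleton_orientation[OF Q(1) sk(1)] sk(2) finite_subset acyclic_subset by blast+
    show "a = b" if E: "(a, c) \<in> ?E" "(b, c) \<in> ?E" "c \<noteq> sink ori F" for a b c
    proof -
      obtain d where "(c, d) \<in> ?E" using out edges(4)[OF E(1)] E(3) by blast
      then show ?thesis
        using two[of c a b d] edges(1)[of c d] edges(2)[OF E(1)] edges(2)[OF E(2)] asym E by blast
    qed
    show "b = c" if E: "(a, b) \<in> ?E" "(a, c) \<in> ?E" "a \<noteq> srce ori F" for a b c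
    proof -
      obtain d where "(d, a) \<in> ?E" using into edges(3)[OF E(1)] E(3) by blast
      then show ?thesis
        using two[of a b c d] edges(2)[of d a] edges(1)[OF E(1)] edges(1)[OF E(2)] asym E by blast
    qed
    show "a = b \<or> b = c \<or> a = c" if "(srce ori F, a) \<in> ?E" "(srce ori F, b) \<in> ?E" "(srce ori F, c) \<in> ?E" for a b c
      using two edges(1) that by blast
    show "(a, srce ori F) \<notin> ?E" for a using src unfolding is_source_def by blast
    show "(sink ori F, a) \<notin> ?E" for a using snk unfolding is_sink_def by blast
    show "\<exists>c. (b, c) \<in> ?E" if "(a, b) \<in> ?E" "b \<noteq> sink ori F" for a b
      using out edges(4) that by blast
  qed
qed

text \<open>Finiteness allows induction on the size of the interval: an inner element splits it into
  two strictly smaller intervals.\<close>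

lemma cover_rel_rtrancl:
  assumes "lattice L" "finite (carrier L)" "x \<in> carrier L" "y \<in> carrier L"
  shows "(x, y) \<in> (cover_rel L)\<^sup>* \<longleftrightarrow> x \<sqsubseteq>\<^bsub>L\<^esub> y"
proof
  interpret L: lattice L by fact
  assume "(x, y) \<in> (cover_rel L)\<^sup>*"
  then have "y \<in> carrier L \<and> x \<sqsubseteq>\<^bsub>L\<^esub> y"
  proof (induction rule: rtrancl_induct)
    case (step y z)
    then have "z \<in> carrier L" "y \<sqsubseteq>\<^bsub>L\<^esub> z" by (auto simp: cover_rel_def lless_def)
    then show ?case using step.IH assms(3) L.le_trans by blast
  qed (use assms(3) in simp)
  then show "x \<sqsubseteq>\<^bsub>L\<^esub> y" by blast
next
  interpret L: lattice L by fact
  define I where "I x y = {z \<in> carrier L. x \<sqsubseteq>\<^bsub>L\<^esub> z \<and> z \<sqsubseteq>\<^bsub>L\<^esub> y}" for x y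
  assume "x \<sqsubseteq>\<^bsub>L\<^esub> y"
  then show "(x, y) \<in> (cover_rel L)\<^sup>*"
    using assms(3,4)
  proof (induction "card (I x y)" arbitrary: x y rule: less_induct)
    case less
    consider "x = y" | "(x, y) \<in> cover_rel L" | z where "z \<in> carrier L" "x \<sqsubset>\<^bsub>L\<^esub> z" "z \<sqsubset>\<^bsub>L\<^esub> y"
      using less.prems by (auto simp: cover_rel_def lless_def L.eq_is_equal)
    then show ?case
    proof cases
      case 3
      then have z: "x \<sqsubseteq>\<^bsub>L\<^esub> z" "z \<sqsubseteq>\<^bsub>L\<^esub> y" "x \<noteq> z" "z \<noteq> y" by (auto simp: lless_def L.eq_is_equal)
      have fin: "finite (I x y)" using assms(2) by (simp add: I_def)
      have "I x z \<subset> I x y"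
      proof
        show "I x z \<subseteq> I x y"
          unfolding I_def using L.le_trans[OF _ z(2)] 3(1) less.prems(3) by blast
        have "y \<in> I x y" "y \<notin> I x z"
          unfolding I_def using L.le_antisym[OF z(2)] z(4) 3(1) less.prems by auto
        then show "I x z \<noteq> I x y" by blast
      qed
      moreover have "I z y \<subset> I x y"
      proof
        show "I z y \<subseteq> I x y"
          unfolding I_def using L.le_trans[OF z(1)] 3(1) less.prems(2) by blast
        have "x \<in> I x y" "x \<notin> I z y"
          unfolding I_def using L.le_antisym[OF z(1)] z(3) 3(1) less.prems by auto
        then show "I z y \<noteq> I x y" by blast
      qed
      ultimately have "card (I x z) < card (I x y)" "card (I z y) < card (I x y)"
        using psubset_card_mono[OF fin] by blast+
      then have "(x, z) \<in> (cover_rel L)\<^sup>*" "(z, y) \<in> (cover_rel L)\<^sup>*"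
        using less.hyps[of x z] less.hyps[of z y] less.prems 3(1) z(1,2) by simp_all
      then show ?thesis by (rule rtrancl_trans)
    qed auto
  qed
qed

text \<open>The core of \<open>differ_by_move\<close>, without the common prefix and suffix; it
  instantiates \<open>W\<close>.\<close>

definition face_move :: "'a::euclidean_space set \<Rightarrow> 'a rel \<Rightarrow> 'a list \<Rightarrow> 'a list \<Rightarrow> bool" where
  "face_move Q ori p q \<longleftrightarrow>
     (\<exists>F. F face_of Q \<and> aff_dim F = 2 \<and> boundary_path ori F p \<and> boundary_path ori F q \<and> p \<noteq> q)"

lemma face_moves_polytope:
  assumes Q: "polytope Q" "facial_orientation Q ori" "directionally_simple Q ori"
    and L: "lattice L" "carrier L = vertices_of Q" "ori = cover_rel L"
  shows "face_moves ori (face_move Q ori)"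
proof -
  interpret L: lattice L by fact
  have sk: "skeleton_orientation Q ori" "acyclic ori" using Q(2) by (auto simp: facial_orientation_def)
  have fin: "finite (carrier L)"
    using finite_polyhedron_extreme_points[OF polytope_imp_polyhedron[OF Q(1)]] L(2)
    by (simp add: vertices_of_def)
  have carr: "x \<in> carrier L" "y \<in> carrier L" if "(x, y) \<in> ori" for x y
    using that L(3) by (auto simp: cover_rel_def)
  have rt: "(x, y) \<in> ori\<^sup>* \<longleftrightarrow> x \<sqsubseteq>\<^bsub>L\<^esub> y" if "x \<in> carrier L" "y \<in> carrier L" for x y
    using cover_rel_rtrancl[OF L(1) fin that] L(3) by simp
  have rtc: "y \<in> carrier L" if "(x, y) \<in> ori\<^sup>*" "x \<in> carrier L" for x y
    using that carr(2) by (induction rule: rtrancl_induct) auto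
  have convQ: "convex Q" using Q(1) polytope_imp_convex by blast
  note poly = polygon_orientation_face(3)[OF Q(1,2)]
  have sub: "restrict_orientation ori F \<subseteq> ori" for F by (auto simp: restrict_orientation_def)
  have edge: "closed_segment x y edge_of F" "closed_segment y x edge_of F"
    if "boundary_path ori F (xs @ x # y # ys)" for F xs x y ys
    using restrict_orientationD(2)[OF directed_path_edge] that
    by (metis boundary_path_def closed_segment_commute)+
  show ?thesis
  proof
    show "finite ori" by (rule finite_skeleton_orientation[OF Q(1) sk(1)])
    show "acyclic ori" by (rule sk(2))
    show "y = x \<or> y = z" if "(x, z) \<in> ori" "(x, y) \<in> ori\<^sup>*" "(y, z) \<in> ori\<^sup>*" for x y z
    proof -
      have y: "y \<in> carrier L" using rtc that(1,2) carr by blast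
      then have "x \<sqsubseteq>\<^bsub>L\<^esub> y" "y \<sqsubseteq>\<^bsub>L\<^esub> z" using rt that carr by blast+
      then show ?thesis using that(1) y L(3) by (auto simp: cover_rel_def lless_def L.eq_is_equal)
    qed
    show "\<exists>w. (y, w) \<in> ori\<^sup>* \<and> (z, w) \<in> ori\<^sup>* \<and> (\<forall>v. (y, v) \<in> ori\<^sup>* \<and> (z, v) \<in> ori\<^sup>* \<longrightarrow> (w, v) \<in> ori\<^sup>*)"
      if "(x, y) \<in> ori" "(x, z) \<in> ori" for x y z
    proof -
      have yz: "y \<in> carrier L" "z \<in> carrier L" using carr that by blast+
      have c: "y \<squnion>\<^bsub>L\<^esub> z \<in> carrier L" using yz by simp
      have "(y, y \<squnion>\<^bsub>L\<^esub> z) \<in> ori\<^sup>*" "(z, y \<squnion>\<^bsub>L\<^esub> z) \<in> ori\<^sup>*"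
        using rt c yz L.join_left L.join_right by simp_all
      moreover have "(y \<squnion>\<^bsub>L\<^esub> z, v) \<in> ori\<^sup>*" if "(y, v) \<in> ori\<^sup>*" "(z, v) \<in> ori\<^sup>*" for v
        using rtc[OF that(1) yz(1)] that yz c rt L.join_le by simp
      ultimately show ?thesis by blast
    qed
    show "face_move Q ori q p" if "face_move Q ori p q" for p q
      using that unfolding face_move_def by metis
    show "\<exists>x y z p' q'. p = x # y # p' \<and> q = x # z # q' \<and> y \<noteq> z" if "face_move Q ori p q" for p q
      using that polygon_orientation.boundary_path_form[OF poly]
      unfolding face_move_def boundary_path_def by metis
    show "directed_path ori (hd p) (last p) p" if "face_move Q ori p q" for p q
      using that directed_path_mono[OF sub]
      unfolding face_move_def boundary_path_def by (auto simp: directed_path_def)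
    show "last p = last q" if "face_move Q ori p q" for p q
      using that unfolding face_move_def boundary_path_def by (auto simp: directed_path_def)
    show "m = hd p \<or> m = last p" if W: "face_move Q ori p q" "m \<in> set p" "m \<in> set q" for p q m
    proof -
      obtain F where F: "F face_of Q" "aff_dim F = 2" "boundary_path ori F p" "boundary_path ori F q" "p \<noteq> q"
        using W(1) unfolding face_move_def by blast
      then show ?thesis
        using polygon_orientation.boundary_paths_disjoint[OF poly[OF F(1,2)], of p q m] W(2,3)
        unfolding boundary_path_def by (auto simp: directed_path_def)
    qed
    show "\<exists>p q. face_move Q ori (x # y # p) (x # z # q)"
      if xyz: "(x, y) \<in> ori" "(x, z) \<in> ori" "y \<noteq> z" for x y z
    proof -
      have eQ: "closed_segment x y edge_of Q" "closed_segment x z edge_of Q"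
        using xyz sk(1) unfolding skeleton_orientation_def by blast+
      let ?e = "closed_segment x y" and ?f = "closed_segment x z"
      have "?e \<noteq> ?f"
      proof
        assume "?e = ?f"
        then have "z \<in> ?e" using ends_in_segment(2) by metis
        then show False
          using edge_of_segment_other[OF eQ(1) edge_of_segment_endpoints(2)[OF eQ(2)]]
            edge_of_segment_endpoints(3)[OF eQ(2)] xyz(3) by blast
      qed
      \<comment> \<open>Directional simplicity is applied to this two-element set of edges, which
        yields a 2-face.\<close>
      have "{?e, ?f} \<subseteq> out_edges ori x" using xyz by (auto simp: out_edges_def)
      moreover have "x \<in> vertices_of Q" using carr(1) xyz(1) L(2) by blast
      ultimately obtain F where F: "F face_of Q" "aff_dim F = int (card {?e, ?f})" "x \<in> F"
        "?e \<subseteq> F" "?f \<subseteq> F"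
        using Q(3) unfolding directionally_simple_def by (metis insertCI)
      have F2: "aff_dim F = 2" using F(2) \<open>?e \<noteq> ?f\<close> by simp
      have eF: "?e edge_of F" "?f edge_of F"
        using eQ F(1,4,5) face_of_face[OF F(1)] by (auto simp: edge_of_def)
      have E: "(x, y) \<in> restrict_orientation ori F" "(x, z) \<in> restrict_orientation ori F"
        using xyz eF by (auto simp: restrict_orientation_def)
      \<comment> \<open>The only neighbours of \<open>x\<close> in \<open>F\<close> are
        \<open>y\<close> and \<open>z\<close>, and both edges leave \<open>x\<close>.\<close>
      have "is_source ori F x"
        unfolding is_source_def
      proof
        show "x \<in> vertices_of F" using edge_of_segment_endpoints(1)[OF eF(1)] by (simp add: vertices_of_def)
        show "\<nexists>w. (w, x) \<in> restrict_orientation ori F"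
        proof
          assume "\<exists>w. (w, x) \<in> restrict_orientation ori F"
          then obtain w where w: "(w, x) \<in> restrict_orientation ori F" by blast
          then have "closed_segment x w edge_of F" "(w, x) \<in> ori"
            using restrict_orientationD[OF w] by (auto simp: closed_segment_commute)
          then have "w = y \<or> w = z"
            using polygon_vertex_edges[OF face_of_imp_convex[OF F(1)] F2 eF, of w] xyz(3) by blast
          then show False using \<open>(w, x) \<in> ori\<close> xyz sk(1) unfolding skeleton_orientation_def by blast
        qed
      qed
      then have x: "x = srce ori F" by (rule polygon_orientation_face(2)[OF Q(1,2) F(1) F2])
      obtain p where "directed_path (restrict_orientation ori F) y (sink ori F) (y # p)"
        using polygon_orientation.path_to_sink[OF poly[OF F(1) F2] E(1)] by blast
      then have p: "boundary_path ori F (x # y # p)"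
        unfolding boundary_path_def using E(1) x by (auto simp: directed_path_Cons_iff)
      obtain q where "directed_path (restrict_orientation ori F) z (sink ori F) (z # q)"
        using polygon_orientation.path_to_sink[OF poly[OF F(1) F2] E(2)] by blast
      then have q: "boundary_path ori F (x # z # q)"
        unfolding boundary_path_def using E(2) x by (auto simp: directed_path_Cons_iff)
      show ?thesis using p q F(1) F2 xyz(3) unfolding face_move_def by blast
    qed
    show "p = p'" if W: "face_move Q ori (x # y # p) (x # z # q)" "face_move Q ori (x # y # p') (x # z # q')"
      for x y z p q p' q'
    proof -
      obtain F where F: "F face_of Q" "aff_dim F = 2" "boundary_path ori F (x # y # p)"
        "boundary_path ori F (x # z # q)" "x # y # p \<noteq> x # z # q"
        using W(1) unfolding face_move_def by blast
      obtain G where G: "G face_of Q" "aff_dim G = 2" "boundary_path ori G (x # y # p')"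
        "boundary_path ori G (x # z # q')"
        using W(2) unfolding face_move_def by blast
      have "y \<noteq> z"
        using polygon_orientation.boundary_path_form[OF poly[OF F(1,2)]] F(3-5)
        unfolding boundary_path_def by blast
      then have "F = G"
        using polygon_face_eq[OF convQ F(1,2) G(1,2), of x y z] edge(1)[of F "[]"] edge(1)[of G "[]"] F(3,4) G(3,4)
        by simp
      then show ?thesis
        using polygon_orientation.boundary_path_determined[OF poly[OF F(1,2)]] F(3) G(3)
        unfolding boundary_path_def by (metis directed_path_def list.sel(1))
    qed
    show "xs @ x # y # z # ys = xs' @ x # y # z # ys' \<and> q = q'"
      if W: "face_move Q ori (xs @ x # y # z # ys) q" "face_move Q ori (xs' @ x # y # z # ys') q'"
      for xs x y z ys q xs' ys' q'
    proof -
      obtain F where F: "F face_of Q" "aff_dim F = 2" "boundary_path ori F (xs @ x # y # z # ys)"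
        "boundary_path ori F q" "xs @ x # y # z # ys \<noteq> q"
        using W(1) unfolding face_move_def by blast
      obtain G where G: "G face_of Q" "aff_dim G = 2" "boundary_path ori G (xs' @ x # y # z # ys')"
        "boundary_path ori G q'" "xs' @ x # y # z # ys' \<noteq> q'"
        using W(2) unfolding face_move_def by blast
      have "(x, y) \<in> ori" "(y, z) \<in> ori"
        using directed_path_edge[of _ _ _ xs x y "z # ys"] directed_path_edge[of _ _ _ "xs @ [x]" y z ys]
          F(3) restrict_orientationD(1) unfolding boundary_path_def by fastforce+
      \<comment> \<open>Antisymmetry makes the two edges at \<open>y\<close> distinct, so they
        determine the 2-face.\<close>
      then have "x \<noteq> z" using sk(1) unfolding skeleton_orientation_def by blast
      then have "F = G"
        using polygon_face_eq[OF convQ F(1,2) G(1,2), of y x z]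
          edge(2)[of F xs x y "z # ys"] edge(2)[of G xs' x y "z # ys'"]
          edge(1)[of F "xs @ [x]" y z ys] edge(1)[of G "xs' @ [x]" y z ys'] F(3) G(3)
        by simp
      then show ?thesis
        using polygon_orientation.boundary_path_triple[OF poly[OF F(1,2)]]
          polygon_orientation.boundary_path_other[OF poly[OF F(1,2)]] F G
        unfolding boundary_path_def by metis
    qed
  qed
qed

section \<open>Connectivity of the move graph as a digraph\<close>

lemma connected_induce_subgraphI:
  assumes "V \<noteq> {}" "V \<subseteq> verts G"
    and "\<And>c d. c \<in> V \<Longrightarrow> d \<in> V \<Longrightarrow> (c, d) \<in> (arcs_ends G \<inter> V \<times> V)\<^sup>*"
  shows "Digraph_Component.connected (G \<restriction> V)"
  \<comment> \<open>Connectivity means strong connectivity of the symmetric closure, so directed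
    reachability within \<open>V\<close> suffices, together with nonemptiness.\<close>
  unfolding Digraph_Component.connected_def
proof (rule strongly_connectedI)
  show "verts (with_proj (mk_symmetric (G \<restriction> V))) \<noteq> {}" using assms(1) by simp
next
  fix c d assume "c \<in> verts (with_proj (mk_symmetric (G \<restriction> V)))" "d \<in> verts (with_proj (mk_symmetric (G \<restriction> V)))"
  then have cd: "c \<in> V" "d \<in> V" by simp_all
  have sub: "arcs_ends G \<inter> V \<times> V \<subseteq> arcs_ends (with_proj (mk_symmetric (G \<restriction> V)))"
    unfolding arcs_ends_def arc_to_ends_def mk_symmetric_def by force
  from assms(3)[OF cd] show "c \<rightarrow>\<^sup>*\<^bsub>with_proj (mk_symmetric (G \<restriction> V))\<^esub> d"
  proof (induction rule: rtrancl_induct)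
    case base
    then show ?case using cd by (simp add: reachable_def rtrancl_on_refl)
  next
    case (step y z)
    then show ?case
      using sub unfolding reachable_def by (auto intro: rtrancl_on_into_rtrancl_on)
  qed
qed

theorem theorem1p2:
  fixes Q :: "'a::euclidean_space set"
    and ori :: "'a rel"
    and L :: "'a gorder"
    and u v :: 'a
    and a :: nat
  assumes "polytope Q"
    and "facial_orientation Q ori"
    and "directionally_simple Q ori"
    and "lattice L"
    and "carrier L = vertices_of Q"
    and "ori = cover_rel L"
    and "u \<in> carrier L" and "v \<in> carrier L" and "u \<sqsubseteq>\<^bsub>L\<^esub> v"
    and "a = card (interval_atoms L u v)"
  shows "Digraph_Component.connected (move_graph Q ori L u v) \<and>
    (a \<ge> 2 \<longrightarrow>
      (\<forall>S \<subseteq> verts (move_graph Q ori L u v). finite S \<and> card S \<le> a - 2 \<longrightarrow>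
         Digraph_Component.connected
           (move_graph Q ori L u v \<restriction> (verts (move_graph Q ori L u v) - S))))"
proof -
  interpret face_moves ori "face_move Q ori" by (rule face_moves_polytope[OF assms(1-6)])
  interpret L: lattice L by fact
  let ?G = "move_graph Q ori L u v"
  have fin: "finite (carrier L)"
    using finite_polyhedron_extreme_points[OF polytope_imp_polyhedron[OF assms(1)]] assms(5)
    by (simp add: vertices_of_def)
  have rt: "(x, y) \<in> ori\<^sup>* \<longleftrightarrow> x \<sqsubseteq>\<^bsub>L\<^esub> y" if "x \<in> carrier L" "y \<in> carrier L" for x y
    using cover_rel_rtrancl[OF assms(4) fin that] assms(6) by simp
  have carr: "x \<in> carrier L" "y \<in> carrier L" if "(x, y) \<in> ori" for x y
    using that assms(6) by (auto simp: cover_rel_def)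
  have at: "interval_atoms L u v = atoms v u"
  proof -
    have "u \<sqsubseteq>\<^bsub>L\<^esub> x" if "(u, x) \<in> ori" for x
      using carr[OF that] rt[of u x] that by blast
    then have "x \<in> interval_atoms L u v \<longleftrightarrow> x \<in> atoms v u" for x
      using carr[of u x] rt[of x v] assms(8)
      unfolding interval_atoms_def atoms_def at_least_at_most_def assms(6)[symmetric] by auto
    then show ?thesis by blast
  qed
  have chains: "saturated_chains L u v = Collect (directed_path ori u v)"
  proof -
    \<comment> \<open>The carrier condition on chains is automatic: a path that starts in the
      carrier stays in it.\<close>
    have "set c \<subseteq> carrier L" if "directed_path ori u v c" for c
    proof
      fix m assume "m \<in> set c"
      then have "(u, m) \<in> ori\<^sup>*" by (rule directed_path_mem[OF that])
      then show "m \<in> carrier L" by (cases rule: rtranclE) (use assms(7) carr in auto)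
    qed
    then show ?thesis using assms(6) by (auto simp: saturated_chains_def)
  qed
  have verts: "verts ?G = Collect (directed_path ori u v)"
    by (simp add: move_graph_def chains)
  have ends: "arcs_ends ?G = {(c, d). directed_path ori u v c \<and> directed_path ori u v d \<and> move c d}"
    unfolding arcs_ends_def arc_to_ends_def move_graph_def chains move_def face_move_def differ_by_move_def
    by (simp, blast)
  have main: "Digraph_Component.connected (?G \<restriction> (verts ?G - S))"
    if S: "S \<subseteq> verts ?G" "finite S" "S = {} \<or> card S + 2 \<le> card (atoms v u)" for S
  proof (rule connected_induce_subgraphI)
    show "verts ?G - S \<noteq> {}"
      using remaining_chain[OF _ S(2,3)] rt assms(7-9) verts by auto
    show "(c, d) \<in> (arcs_ends ?G \<inter> (verts ?G - S) \<times> (verts ?G - S))\<^sup>*"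
      if cd: "c \<in> verts ?G - S" "d \<in> verts ?G - S" for c d
    proof -
      have "(c, d) \<in> (moves u v S)\<^sup>*"
        using robustly_connected[of u v] S cd
        unfolding robustly_connected_def chains_connected_def verts by blast
      moreover have "moves u v S = arcs_ends ?G \<inter> (verts ?G - S) \<times> (verts ?G - S)"
        unfolding ends verts moves_def by auto
      ultimately show ?thesis by simp
    qed
  qed simp
  \<comment> \<open>The first claim is the case of no deletions.\<close>
  have "?G \<restriction> (verts ?G - {}) = ?G"
    by (rule pre_digraph.equality) (auto simp: move_graph_def)
  then have "Digraph_Component.connected ?G" using main[of "{}"] by simp
  moreover have "Digraph_Component.connected (?G \<restriction> (verts ?G - S))"
    if "a \<ge> 2" "S \<subseteq> verts ?G" "finite S" "card S \<le> a - 2" for S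
  proof -
    have "a = card (atoms v u)" using assms(10) at by simp
    \<comment> \<open>Because \<open>a \<ge> 2\<close>, the natural number \<open>a - 2\<close> is
      not truncated.\<close>
    then have "card S + 2 \<le> card (atoms v u)" using that(1,4) by simp
    then show ?thesis using main[OF that(2,3)] by blast
  qed
  ultimately show ?thesis by blast
qed

end
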